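(* Let $A$ be a local domain with quotient field $K$, and let $v_0$ be a valuation of $K$ which dominates $A$. Suppose that $f(x)\in A[x]$ is monic and that $f(x)$ is irreducible in $K[x]$. Suppose that the characteristic $p$ of the residue field of $A$ does not divide $\deg f$, and that there is a unique extension $v$ of $v_0$ to the quotient field $K[x]/(f(x))$ of $A[x]/(f(x))$. Then there exists a finite sequence of inductive values $v_1,\ldots,v_n$ extending $v_0$ to $K[x]$, with respective associated key polynomials $\phi_1=x,\phi_2,\ldots,\phi_n=f$, such that $v_k=[v_{k-1};v_k(\phi_k)=v(\phi_k)]$ for $1\le k\le n$, $v$ is the valuation on $A[x]/(f(x))$ induced by the pseudo valuation $v_n$, and $\phi_i\in A[x]$ for all $1\le i\le n$.
   Context: A local ring is a commutative ring with a unique maximal ideal (not necessarily Noetherian); $m_A$ denotes the maximal ideal of $A$. Valuations are Krull valuations of arbitrary rank, written additively. The valuation ring of $v_0$ is $\mathcal O_{v_0}$, with maximal ideal $m_{v_0}$; $v_0$ dominates $A$ if $A\subset\mathcal O_{v_0}$ and $m_{v_0}\cap A=m_A$. A pseudo valuation $w$ on a domain $R$ is a surjective map $w:R\to G_w\cup\{\infty\}$, with $G_w$ a totally ordered abelian group, such that $I(w)_\infty=\{g\in R\mid w(g)=\infty\}$ is a prime ideal of $R$ and $w$ induces a valuation of the quotient field of $R/I(w)_\infty$. The valuation $v$ of $K[x]/(f(x))$ is identified with the pseudo valuation of $K[x]$ obtained by composing with $K[x]\to K[x]/(f(x))$; so $v(g)$ makes sense for $g\in K[x]$, and $v(g)=\infty$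 exactly when $f\mid g$. Let $w$ be a valuation or pseudo valuation on $K[x]$. For $g,h\in K[x]$ write $g\sim_w h$ (equivalent in $w$) if $w(g-h)>\min\{w(g),w(h)\}$ or $w(g)=w(h)=\infty$. Write $h|_w g$ ($g$ is equivalence divisible by $h$ in $w$) if there is $a\in K[x]$ with $g\sim_w ah$. An element $g$ is equivalence irreducible in $w$ if $g|_w ab$ implies $g|_w a$ or $g|_w b$. Inductive values (MacLane). The first one is $v_1=[v_0;v_1(\phi_1)=\mu_1]$ with $\phi_1=x$, given by $v_1(\sum a_ix^i)=\min_i\{v_0(a_i)+i\mu_1\}$. For $k\ge 2$, $v_k=[v_{k-1};v_k(\phi_k)=\mu_k]$ is defined as follows, where $\phi_k$ is a key polynomial over $v_{k-1}$ with key value $\mu_k$: if $g=g_m\phi_k^m+\cdots+g_0$ is the unique expansion with $g_i\in K[x]$ and $\deg g_i<\deg\phi_k$, then $v_k(g)=\min_i\{v_{k-1}(g_i)+i\mu_k\}$. The value $\mu_k=\infty$ is allowed at the last step, in which case $v_k$ is a pseudo valuation with $I(v_k)_\infty=(\phi_k)$. The values $\mu_k$ lie in $\{\infty\}$ or in a totally ordered abelian group containing the value group of $v_0$ (here the value group of $v$). For $k\ge 2$, $\phi_k\in K[x]$ is a key polynomial with key value $\mu_k$ over $v_{k-1}$ if: (1) $\phi_k$ is equivalence irreducible in $v_{k-1}$; (2) $\phi_k$ is minimal in $v_{k-1}$, i.e. if $\phi_k|_{v_{k-1}}g$ with $g\neq 0$ then $\deg\phi_k\le\deg g$; (3) $\phi_k$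 is monic of positive degree; (4) $\mu_k>v_{k-1}(\phi_k)$; (5) $\deg\phi_k\ge\deg\phi_{k-1}$; (6) $\phi_k\sim_{v_{k-1}}\phi_{k-1}$ is false. *)

theory Defs
  imports "HOL-Algebra.Algebraic_Closure_Type"
begin

section \<open>Values: an ordered abelian group with infinity adjoined\<close>

datatype 'g with_infty = Fin 'g | Infty

instantiation with_infty :: (linorder) linorder
begin

fun less_eq_with_infty :: "'a with_infty \<Rightarrow> 'a with_infty \<Rightarrow> bool" where
  "less_eq_with_infty _ Infty = True"
| "less_eq_with_infty (Fin a) (Fin b) = (a \<le> b)"
| "less_eq_with_infty Infty (Fin b) = False"

definition less_with_infty :: "'a with_infty \<Rightarrow> 'a with_infty \<Rightarrow> bool" where
  "less_with_infty a b \<longleftrightarrow> a \<le> b \<and> \<not> b \<le> a"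

instance
proof
  fix x y z :: "'a with_infty"
  show "x < y \<longleftrightarrow> x \<le> y \<and> \<not> y \<le> x" by (rule less_with_infty_def)
  show "x \<le> x" by (cases x) auto
  show "x \<le> y \<Longrightarrow> y \<le> z \<Longrightarrow> x \<le> z" by (cases x; cases y; cases z) auto
  show "x \<le> y \<Longrightarrow> y \<le> x \<Longrightarrow> x = y" by (cases x; cases y) auto
  show "x \<le> y \<or> y \<le> x" by (cases x; cases y) auto
qed

end

instantiation with_infty :: (linordered_ab_group_add) ordered_comm_monoid_add
begin

definition zero_with_infty :: "'a with_infty" where
  "zero_with_infty = Fin 0"

fun plus_with_infty :: "'a with_infty \<Rightarrow> 'a with_infty \<Rightarrow> 'a with_infty" where
  "plus_with_infty (Fin a) (Fin b) = Fin (a + b)"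
| "plus_with_infty Infty _ = Infty"
| "plus_with_infty _ Infty = Infty"

instance
proof
  fix a b c :: "'a with_infty"
  show "a + b + c = a + (b + c)" by (cases a; cases b; cases c) (auto simp: add.assoc)
  show "a + b = b + a" by (cases a; cases b) (auto simp: add.commute)
  show "0 + a = a" by (cases a) (auto simp: zero_with_infty_def)
  show "a \<le> b \<Longrightarrow> c + a \<le> c + b" by (cases a; cases b; cases c) auto
qed

end


section \<open>Valuations and pseudo valuations\<close>

text \<open>The value group of \<open>w\<close> is the subgroup of \<open>'g\<close> generated by the finite values of \<open>w\<close>;
  \<open>'g\<close> itself may be larger. The three conditions say precisely that \<open>w\<close> factors through
  \<open>R/I(w)\<^sub>\<infinity>\<close> and induces a Krull valuation of its quotient field.\<close>

definition infinity_ideal :: "('a, 'm) ring_scheme \<Rightarrow> ('a \<Rightarrow> 'g with_infty) \<Rightarrow> 'a set" where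
  "infinity_ideal R w = {x \<in> carrier R. w x = Infty}"

definition pseudo_valuation ::
    "('a, 'm) ring_scheme \<Rightarrow> ('a \<Rightarrow> 'g::linordered_ab_group_add with_infty) \<Rightarrow> bool" where
  "pseudo_valuation R w \<longleftrightarrow>
     primeideal (infinity_ideal R w) R \<and>
     (\<forall>x\<in>carrier R. \<forall>y\<in>carrier R. w (x \<otimes>\<^bsub>R\<^esub> y) = w x + w y) \<and>
     (\<forall>x\<in>carrier R. \<forall>y\<in>carrier R. min (w x) (w y) \<le> w (x \<oplus>\<^bsub>R\<^esub> y))"

definition valuation ::
    "('a, 'm) ring_scheme \<Rightarrow> ('a \<Rightarrow> 'g::linordered_ab_group_add with_infty) \<Rightarrow> bool" where
  "valuation F w \<longleftrightarrow> pseudo_valuation F w \<and> infinity_ideal F w = {\<zero>\<^bsub>F\<^esub>}"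

definition valuation_ring ::
    "('a, 'm) ring_scheme \<Rightarrow> ('a \<Rightarrow> 'g::linordered_ab_group_add with_infty) \<Rightarrow> 'a set" where
  "valuation_ring F w = {x \<in> carrier F. 0 \<le> w x}"

definition valuation_max_ideal ::
    "('a, 'm) ring_scheme \<Rightarrow> ('a \<Rightarrow> 'g::linordered_ab_group_add with_infty) \<Rightarrow> 'a set" where
  "valuation_max_ideal F w = {x \<in> carrier F. 0 < w x}"

definition valuation_subring :: "'a set \<Rightarrow> ('a, 'm) ring_scheme \<Rightarrow> bool" where
  "valuation_subring V F \<longleftrightarrow>
     subring V F \<and> (\<forall>x\<in>carrier F - {\<zero>\<^bsub>F\<^esub>}. x \<in> V \<or> inv\<^bsub>F\<^esub> x \<in> V)"


section \<open>Local subrings of a field\<close>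

definition local_ring :: "('a, 'm) ring_scheme \<Rightarrow> bool" where
  "local_ring R \<longleftrightarrow> cring R \<and> (\<exists>!m. maximalideal m R)"

definition max_ideal :: "('a, 'm) ring_scheme \<Rightarrow> 'a set" where
  "max_ideal R = (THE m. maximalideal m R)"

text \<open>The nonnegative generator of the kernel of \<open>\<int> \<rightarrow> R\<close>, as for \<^const>\<open>semiring_char\<close>.\<close>

definition ring_char :: "('a, 'm) ring_scheme \<Rightarrow> nat" where
  "ring_char R = Gcd {n. [n] \<cdot>\<^bsub>R\<^esub> \<one>\<^bsub>R\<^esub> = \<zero>\<^bsub>R\<^esub>}"

definition subset_ring :: "'k::field set \<Rightarrow> 'k ring" where
  "subset_ring A = ring_of_type_algebra\<lparr>carrier := A\<rparr>"

definition local_domain_with_quotient_field_UNIV :: "'k::field set \<Rightarrow> bool" where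
  "local_domain_with_quotient_field_UNIV A \<longleftrightarrow>
     subdomain A (ring_of_type_algebra :: 'k ring) \<and> local_ring (subset_ring A) \<and>
     (\<forall>x. \<exists>a\<in>A. \<exists>b\<in>A. b \<noteq> 0 \<and> x = a / b)"

definition residue_char :: "'k::field set \<Rightarrow> nat" where
  "residue_char A = ring_char (subset_ring A Quot max_ideal (subset_ring A))"

definition dominates ::
    "('k::field \<Rightarrow> 'g::linordered_ab_group_add with_infty) \<Rightarrow> 'k set \<Rightarrow> bool" where
  "dominates v0 A \<longleftrightarrow>
     A \<subseteq> valuation_ring ring_of_type_algebra v0 \<and>
     valuation_max_ideal ring_of_type_algebra v0 \<inter> A = max_ideal (subset_ring A)"

definition polys_over :: "'k::zero set \<Rightarrow> 'k poly set" where
  "polys_over A = {g. \<forall>i. Polynomial.coeff g i \<in> A}"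


section \<open>The field \<open>K[x]/(f)\<close> and extensions of a valuation to it\<close>

definition poly_quot :: "'k::field poly \<Rightarrow> 'k poly set ring" where
  "poly_quot f = ring_of_type_algebra Quot (PIdl\<^bsub>ring_of_type_algebra\<^esub> f)"

definition poly_class :: "'k::field poly \<Rightarrow> 'k poly \<Rightarrow> 'k poly set" where
  "poly_class f g = (PIdl\<^bsub>ring_of_type_algebra\<^esub> f) +>\<^bsub>ring_of_type_algebra\<^esub> g"

text \<open>Krull valuations are identified when they have the same valuation ring, and competing
  extensions of \<open>v0\<close> need not take values in \<open>'g\<close>. Uniqueness is therefore stated for
  valuation rings: the only valuation ring of \<open>K[x]/(f)\<close> that contracts to the valuation ring of
  \<open>v0\<close> is the one of \<open>v\<close>. This ranges over all extensions, with arbitrary value groups.\<close>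

definition is_extension ::
    "('k::field \<Rightarrow> 'g::linordered_ab_group_add with_infty) \<Rightarrow> 'k poly \<Rightarrow>
     ('k poly set \<Rightarrow> 'g with_infty) \<Rightarrow> bool" where
  "is_extension v0 f v \<longleftrightarrow>
     valuation (poly_quot f) v \<and> (\<forall>a. v (poly_class f [:a:]) = v0 a)"

definition is_unique_extension ::
    "('k::field \<Rightarrow> 'g::linordered_ab_group_add with_infty) \<Rightarrow> 'k poly \<Rightarrow>
     ('k poly set \<Rightarrow> 'g with_infty) \<Rightarrow> bool" where
  "is_unique_extension v0 f v \<longleftrightarrow>
     is_extension v0 f v \<and>
     (\<forall>V. valuation_subring V (poly_quot f) \<and>
          {a. poly_class f [:a:] \<in> V} = valuation_ring ring_of_type_algebra v0
          \<longrightarrow> V = valuation_ring (poly_quot f) v)"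


section \<open>Key polynomials and inductive values\<close>

definition equiv_in ::
    "('k::field poly \<Rightarrow> 'g::linordered_ab_group_add with_infty) \<Rightarrow> 'k poly \<Rightarrow> 'k poly \<Rightarrow> bool" where
  "equiv_in w g h \<longleftrightarrow> w (g - h) > min (w g) (w h) \<or> (w g = Infty \<and> w h = Infty)"

text \<open>\<open>equiv_dvd w h g\<close>: \<open>g\<close> is equivalence divisible by \<open>h\<close> in \<open>w\<close>.\<close>

definition equiv_dvd ::
    "('k::field poly \<Rightarrow> 'g::linordered_ab_group_add with_infty) \<Rightarrow> 'k poly \<Rightarrow> 'k poly \<Rightarrow> bool" where
  "equiv_dvd w h g \<longleftrightarrow> (\<exists>a. equiv_in w g (a * h))"

definition equiv_irreducible ::
    "('k::field poly \<Rightarrow> 'g::linordered_ab_group_add with_infty) \<Rightarrow> 'k poly \<Rightarrow> bool" where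
  "equiv_irreducible w g \<longleftrightarrow>
     (\<forall>a b. equiv_dvd w g (a * b) \<longrightarrow> equiv_dvd w g a \<or> equiv_dvd w g b)"

definition minimal_in ::
    "('k::field poly \<Rightarrow> 'g::linordered_ab_group_add with_infty) \<Rightarrow> 'k poly \<Rightarrow> bool" where
  "minimal_in w \<phi> \<longleftrightarrow>
     (\<forall>g. g \<noteq> 0 \<and> equiv_dvd w \<phi> g \<longrightarrow> Polynomial.degree \<phi> \<le> Polynomial.degree g)"

text \<open>\<open>w\<close> is the previous inductive value and \<open>\<phi>'\<close> its own key polynomial.\<close>

definition key_polynomial ::
    "('k::field poly \<Rightarrow> 'g::linordered_ab_group_add with_infty) \<Rightarrow> 'k poly \<Rightarrow>
     'k poly \<Rightarrow> 'g with_infty \<Rightarrow> bool" where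
  "key_polynomial w \<phi>' \<phi> \<mu> \<longleftrightarrow>
     equiv_irreducible w \<phi> \<and>
     minimal_in w \<phi> \<and>
     Polynomial.lead_coeff \<phi> = 1 \<and> Polynomial.degree \<phi> > 0 \<and>
     \<mu> > w \<phi> \<and>
     Polynomial.degree \<phi> \<ge> Polynomial.degree \<phi>' \<and>
     \<not> equiv_in w \<phi> \<phi>'"

definition nat_mult :: "nat \<Rightarrow> 'g::linordered_ab_group_add with_infty \<Rightarrow> 'g with_infty" where
  "nat_mult i \<mu> = (\<Sum>j<i. \<mu>)"

definition first_value ::
    "('k::field \<Rightarrow> 'g::linordered_ab_group_add with_infty) \<Rightarrow> 'g with_infty \<Rightarrow>
     'k poly \<Rightarrow> 'g with_infty" where
  "first_value v0 \<mu> g =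
     Min ((\<lambda>i. v0 (Polynomial.coeff g i) + nat_mult i \<mu>) ` {..Polynomial.degree g})"

text \<open>\<open>w' = [w; w'(\<phi>) = \<mu>]\<close>. Since \<open>\<phi>\<close> is monic of positive degree, each polynomial has a
  \<open>\<phi>\<close>-expansion, unique up to padding by zero coefficients (which do not affect the minimum),
  so this determines \<open>w'\<close>.\<close>

definition is_augmentation ::
    "('k::field poly \<Rightarrow> 'g::linordered_ab_group_add with_infty) \<Rightarrow> 'k poly \<Rightarrow> 'g with_infty \<Rightarrow>
     ('k poly \<Rightarrow> 'g with_infty) \<Rightarrow> bool" where
  "is_augmentation w \<phi> \<mu> w' \<longleftrightarrow>
     (\<forall>m c. (\<forall>i\<le>m. Polynomial.degree (c i) < Polynomial.degree \<phi>) \<longrightarrow>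
        w' (\<Sum>i\<le>m. c i * \<phi> ^ i) = Min ((\<lambda>i. w (c i) + nat_mult i \<mu>) ` {..m}))"

text \<open>\<open>V 1, \<dots>, V n\<close> are inductive values extending \<open>v0\<close>, with key polynomials \<open>\<phi> 1 = x, \<dots>, \<phi> n\<close>
  and key values \<open>\<mu> 1, \<dots>, \<mu> n\<close>, of which only \<open>\<mu> n\<close> may be infinite.\<close>

definition inductive_values ::
    "('k::field \<Rightarrow> 'g::linordered_ab_group_add with_infty) \<Rightarrow> nat \<Rightarrow> (nat \<Rightarrow> 'k poly) \<Rightarrow>
     (nat \<Rightarrow> 'g with_infty) \<Rightarrow> (nat \<Rightarrow> 'k poly \<Rightarrow> 'g with_infty) \<Rightarrow> bool" where
  "inductive_values v0 n \<phi> \<mu> V \<longleftrightarrow>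
     1 \<le> n \<and> \<phi> 1 = [:0, 1:] \<and> V 1 = first_value v0 (\<mu> 1) \<and>
     (\<forall>k\<in>{2..n}. key_polynomial (V (k - 1)) (\<phi> (k - 1)) (\<phi> k) (\<mu> k) \<and>
                 is_augmentation (V (k - 1)) (\<phi> k) (\<mu> k) (V k)) \<and>
     (\<forall>k\<in>{1..<n}. \<mu> k \<noteq> Infty)"

end

theory Submission
  imports Defs
begin

text \<open>
  Write \<open>u g\<close> for the value under \<open>v\<close> of the class of \<open>g\<close>. This is a pseudo valuation of \<open>K[x]\<close>, and
  \<open>u g = \<infinity>\<close> exactly when \<open>f\<close> divides \<open>g\<close>. For monic \<open>Q\<close> the truncation \<open>u\<^sub>Q\<close> sends a polynomial with
  \<open>Q\<close>-expansion \<open>\<Sum> c\<^sub>i Q\<^sup>i\<close> to the minimum of the \<open>u c\<^sub>i + i u Q\<close>. Every inductive value of the chain is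
  the truncation at its own key polynomial; truncating at \<open>x\<close> gives the first one, and truncating
  at \<open>f\<close> gives \<open>u\<close> back.

  Suppose \<open>w = u\<^sub>\<phi>\<close> is not yet \<open>u\<close>, and let \<open>Q\<close> be monic of least degree with \<open>w Q < u Q\<close>. Below that
  degree \<open>w\<close> and \<open>u\<close> agree, and this makes \<open>Q\<close> a key polynomial over \<open>w\<close> and \<open>u\<^sub>Q\<close> the augmentation
  of \<open>w\<close> (locale \<open>key_step\<close>). The difficulty is that \<open>Q\<close> need not have coefficients in \<open>A\<close>.

  Uniqueness of the extension is used to show that \<open>f\<close> is equivalent in \<open>w\<close> to a power \<open>Q\<^sup>e\<close>. By
  Chevalley's extension theorem (\<open>chevalley_extension\<close>) the valuation ring of \<open>v\<close>, being the only
  one over that of \<open>v\<^sub>0\<close>, is integral over it (\<open>valuation_ring_integral\<close>); since also some multiple of \<open>u Q\<close> is a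
  value of \<open>v\<^sub>0\<close>, there is a monic \<open>\<chi> = \<Sum> a\<^sub>i y\<^sup>i\<close> of some degree \<open>N\<close> over \<open>K\<close> with \<open>f\<close> dividing \<open>\<chi>(Q)\<close>
  and \<open>v\<^sub>0 a\<^sub>i \<ge> (N - i) u Q\<close> (\<open>power_relation\<close>). Write \<open>\<chi>(Q) = f q\<close>. From \<open>w\<close> to \<open>u\<^sub>Q\<close> the value of
  \<open>\<chi>(Q)\<close> grows by at least \<open>N (u Q - w Q)\<close>, while the value of a polynomial \<open>g\<close> grows by at most
  \<open>i (u Q - w Q)\<close> whenever the term of index \<open>i\<close> attains \<open>w g\<close>; and \<open>i deg Q \<le> deg g\<close>. As the degrees of
  \<open>f\<close> and \<open>q\<close> add up to \<open>N deg Q\<close>, there is no slack: in the expansion of \<open>f\<close> only the top term \<open>Q\<^sup>e\<close>,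
  with \<open>e deg Q = deg f\<close>, attains the minimum (\<open>equiv_power_of_key\<close>).

  Now \<open>e\<close> divides \<open>deg f\<close>, so it is a unit of \<open>A\<close>, and \<open>f\<close> has exactly one approximate \<open>e\<close>-th root \<open>\<psi>\<close>:
  the monic polynomial with \<open>deg (f - \<psi>\<^sup>e) < deg f - deg \<psi>\<close>. It is the endpoint of a sequence of
  Tschirnhausen transformations from any monic starting point of the same degree. Started in \<open>A[x]\<close>
  they stay in \<open>A[x]\<close>; started at \<open>Q\<close> they stay equivalent to \<open>Q\<close> in \<open>w\<close>. Hence \<open>\<psi>\<close> lies in \<open>A[x]\<close> and can
  replace \<open>Q\<close> as the next key polynomial.

  The same uniqueness makes the chain finite. If the key polynomial after \<open>\<psi>\<close> had the degree of \<open>\<psi>\<close>,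
  it would again be an approximate root, hence equal to \<open>\<psi>\<close>, although \<open>u\<^sub>\<psi>\<close> and \<open>u\<close> agree at \<open>\<psi>\<close>. So
  from the second step on degrees increase strictly. They are bounded by \<open>deg f\<close>, and the chain
  can only stop at \<open>f\<close>.
\<close>


abbreviation pdeg :: "'a::zero poly \<Rightarrow> nat" where
  "pdeg \<equiv> Polynomial.degree"

abbreviation pcoeff :: "'a::zero poly \<Rightarrow> nat \<Rightarrow> 'a" where
  "pcoeff \<equiv> Polynomial.coeff"

section \<open>Arithmetic of values\<close>

lemma Infty_le_iff [simp]: "Infty \<le> x \<longleftrightarrow> x = (Infty :: 'g::linorder with_infty)"
  by (cases x) auto

lemma less_Infty_iff [simp]: "x < (Infty :: 'g::linorder with_infty) \<longleftrightarrow> x \<noteq> Infty"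
  by (cases x) (auto simp: less_with_infty_def)

lemma not_Infty_less [simp]: "\<not> (Infty :: 'g::linorder with_infty) < x"
  by (simp add: less_with_infty_def)

lemma Fin_less_iff [simp]: "Fin a < Fin b \<longleftrightarrow> a < b"
  by (auto simp: less_with_infty_def)

lemma add_Infty [simp]: "x + (Infty :: 'g::linordered_ab_group_add with_infty) = Infty"
  by (cases x) auto

lemma add_eq_Infty_iff [simp]:
  "x + y = (Infty :: 'g::linordered_ab_group_add with_infty) \<longleftrightarrow> x = Infty \<or> y = Infty"
  by (cases x; cases y) auto

lemma zero_ne_Infty [simp]: "(0 :: 'g::linordered_ab_group_add with_infty) \<noteq> Infty"
  by (simp add: zero_with_infty_def)

lemma value_add_le_cancel [simp]:
  fixes c :: "'g::linordered_ab_group_add with_infty"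
  shows "c \<noteq> Infty \<Longrightarrow> c + a \<le> c + b \<longleftrightarrow> a \<le> b"
  by (cases a; cases b; cases c) auto

lemma value_add_cancel:
  fixes c :: "'g::linordered_ab_group_add with_infty"
  shows "c \<noteq> Infty \<Longrightarrow> c + a = c + b \<Longrightarrow> a = b"
  by (cases a; cases b; cases c) auto

lemma value_add_less_cancel [simp]:
  fixes c :: "'g::linordered_ab_group_add with_infty"
  shows "c \<noteq> Infty \<Longrightarrow> c + a < c + b \<longleftrightarrow> a < b"
  by (cases a; cases b; cases c) auto

text \<open>Adding \<open>\<infinity>\<close> is not injective, so strict monotonicity and cancellation need a finite summand.\<close>
lemma value_add_strict_mono:
  fixes a :: "'g::linordered_ab_group_add with_infty"
  shows "a < b \<Longrightarrow> c \<le> d \<Longrightarrow> c \<noteq> Infty \<Longrightarrow> a + c < b + d"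
  by (cases a; cases b; cases c; cases d) (auto intro: add_less_le_mono)

lemma value_add_min:
  fixes c :: "'g::linordered_ab_group_add with_infty"
  shows "c + min a b = min (c + a) (c + b)"
  by (cases a; cases b; cases c) (auto simp: min_def)

lemma value_double_eq_0:
  fixes a :: "'g::linordered_ab_group_add with_infty"
  shows "a + a = 0 \<Longrightarrow> a = 0"
  by (cases a) (auto simp: zero_with_infty_def)

lemma nat_mult_0 [simp]: "nat_mult 0 a = 0"
  by (simp add: nat_mult_def)

lemma nat_mult_Suc [simp]: "nat_mult (Suc n) a = a + nat_mult n a"
  by (simp add: nat_mult_def add.commute)

lemma nat_mult_add: "nat_mult (m + n) a = nat_mult m a + nat_mult n a"
  by (induction m) (auto simp: add.assoc)

lemma nat_mult_mult: "nat_mult (m * n) a = nat_mult m (nat_mult n a)"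
  by (induction m) (auto simp: nat_mult_add)

lemma nat_mult_eq_Infty_iff [simp]: "nat_mult n a = Infty \<longleftrightarrow> n > 0 \<and> a = Infty"
  by (induction n) auto

lemma nat_mult_mono: "a \<le> b \<Longrightarrow> nat_mult n a \<le> nat_mult n b"
  by (induction n) (auto intro: add_mono)

lemma nat_mult_strict_mono:
  assumes "a < b" "n > 0" shows "nat_mult n a < nat_mult n b"
proof -
  obtain m where "n = Suc m" using \<open>n > 0\<close> gr0_implies_Suc by blast
  moreover have "a \<noteq> Infty" using assms(1) by auto
  ultimately show ?thesis
    using value_add_strict_mono[OF assms(1) nat_mult_mono[of a b m]] assms(1) by auto
qed

lemma Min_atMost_Suc:
  fixes h :: "nat \<Rightarrow> 'g::linorder with_infty"
  shows "Min (h ` {..Suc m}) = min (h 0) (Min ((\<lambda>i. h (Suc i)) ` {..m}))"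
proof -
  have "h ` {..Suc m} = insert (h 0) ((\<lambda>i. h (Suc i)) ` {..m})"
    by (auto simp: atMost_Suc_eq_insert_0 image_iff)
  then show ?thesis by simp
qed

lemma add_Min_atMost:
  fixes c :: "'g::linordered_ab_group_add with_infty"
  shows "c + Min (h ` {..m}) = Min ((\<lambda>i. c + h i) ` {..m::nat})"
  by (induction m arbitrary: h) (simp_all add: Min_atMost_Suc value_add_min)


section \<open>Ring valuations\<close>

locale ring_value =
  fixes w :: "'a::comm_ring_1 \<Rightarrow> 'g::linordered_ab_group_add with_infty"
  assumes value_mult: "w (a * b) = w a + w b"
    and value_add: "min (w a) (w b) \<le> w (a + b)"
    and value_0 [simp]: "w 0 = Infty"
    and value_1 [simp]: "w 1 = 0"
begin

lemma value_minus [simp]: "w (- a) = w a"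
proof -
  have "w (-1) + w (-1) = 0" using value_mult[of "-1" "-1"] by simp
  then have "w (-1) = 0" by (rule value_double_eq_0)
  then show ?thesis using value_mult[of "-1" a] by simp
qed

lemma value_add_ge: "c \<le> w a \<Longrightarrow> c \<le> w b \<Longrightarrow> c \<le> w (a + b)"
  by (rule order.trans[OF _ value_add]) simp

lemma value_add_gt: "c < w a \<Longrightarrow> c < w b \<Longrightarrow> c < w (a + b)"
  by (rule less_le_trans[OF _ value_add]) simp

lemma value_diff_ge: "c \<le> w a \<Longrightarrow> c \<le> w b \<Longrightarrow> c \<le> w (a - b)"
  using value_add_ge[of c a "- b"] by simp

lemma value_diff_gt: "c < w a \<Longrightarrow> c < w b \<Longrightarrow> c < w (a - b)"
  using value_add_gt[of c a "- b"] by simp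

lemma value_diff_commute: "w (a - b) = w (b - a)"
  using value_minus[of "a - b"] by simp

lemma value_add_eq: assumes "w a < w b" shows "w (a + b) = w a"
proof (rule antisym)
  show "w (a + b) \<le> w a"
  proof (rule ccontr)
    assume "\<not> ?thesis"
    then have "w a < w (a + b - b)" using assms by (intro value_diff_gt) auto
    then show False by simp
  qed
qed (use assms in \<open>auto intro: value_add_ge\<close>)

lemma value_eq_of_diff: assumes "w a < w (b - a)" shows "w b = w a"
  using value_add_eq[OF assms] by simp

lemma value_sum_gt:
  assumes "c \<noteq> Infty" "\<And>i. i \<in> I \<Longrightarrow> c < w (h i)" shows "c < w (sum h I)"
  using assms(2) by (induction I rule: infinite_finite_induct) (auto intro: value_add_gt simp: assms(1))

lemma value_power: "w (a ^ n) = nat_mult n (w a)"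
  by (induction n) (auto simp: value_mult)

lemma value_power_diff_gt:
  assumes "w a < w (b - a)" "n > 0"
  shows "nat_mult n (w a) < w (b ^ n - a ^ n)"
  using \<open>n > 0\<close>
proof (induction n rule: nat_induct_non_zero)
  case 1
  then show ?case using assms by simp
next
  case (Suc n)
  have fin: "w a \<noteq> Infty" using assms(1) by auto
  have b: "w b = w a" by (rule value_eq_of_diff[OF assms(1)])
  have "w a + nat_mult n (w a) < w (b * (b ^ n - a ^ n) + (b - a) * a ^ n)"
  proof (rule value_add_gt)
    show "w a + nat_mult n (w a) < w (b * (b ^ n - a ^ n))"
      using Suc.IH fin by (simp add: value_mult b)
    show "w a + nat_mult n (w a) < w ((b - a) * a ^ n)"
      using assms(1) fin by (auto simp: value_mult value_power intro: value_add_strict_mono)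
  qed
  then show ?case by (simp add: algebra_simps)
qed

end


section \<open>Truncated valuations\<close>

lemma degree_mod_lt: "pdeg Q > 0 \<Longrightarrow> pdeg (g mod Q) < pdeg (Q :: 'k::field poly)"
  using degree_mod_less[of Q g] by (cases "Q = 0"; cases "g mod Q = 0") auto

lemma expansion_step_div_mod:
  assumes "pdeg c < pdeg (Q :: 'k::field poly)"
  shows "(c + h * Q) mod Q = c" "(c + h * Q) div Q = h"
proof -
  have "Q \<noteq> 0" using assms by auto
  then show "(c + h * Q) mod Q = c" "(c + h * Q) div Q = h"
    using assms by (simp_all add: mod_poly_less div_poly_less)
qed

text \<open>The truncation of \<open>u\<close> at \<open>Q\<close>: the minimum of \<open>u c\<^sub>i + i u Q\<close> over the \<open>Q\<close>-expansion, computed by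
  splitting off the lowest coefficient. A constant \<open>Q\<close> has no expansions; there the value is \<open>u g\<close>
  by convention.\<close>
function truncation ::
    "('k::field poly \<Rightarrow> 'g::linordered_ab_group_add with_infty) \<Rightarrow> 'k poly \<Rightarrow> 'k poly \<Rightarrow> 'g with_infty"
  where
  "truncation u Q g =
     (if pdeg Q = 0 \<or> pdeg g < pdeg Q then u g
      else min (u (g mod Q)) (u Q + truncation u Q (g div Q)))"
  by auto
termination
  by (relation "measure (\<lambda>(u, Q, g). pdeg g)") (auto intro!: degree_div_less)

declare truncation.simps [simp del]


text \<open>The inductive values appear in two forms: a one-step recursion on the lowest coefficient, which
  suits inductions, and the closed formula of \<^const>\<open>is_augmentation\<close>. This links them, for
  truncations and for any other valuation that obeys the recursion.\<close>
lemma value_expansion: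
  fixes val u :: "'k::field poly \<Rightarrow> 'g::linordered_ab_group_add with_infty"
  assumes step: "\<And>c h. pdeg c < pdeg Q \<Longrightarrow> val (c + h * Q) = min (u c) (\<mu> + val h)"
    and zero: "val 0 = Infty"
    and c: "\<forall>i\<le>m. pdeg (c i) < pdeg Q"
  shows "val (\<Sum>i\<le>m. c i * Q ^ i) = Min ((\<lambda>i. u (c i) + nat_mult i \<mu>) ` {..m})"
  using c
proof (induction m arbitrary: c)
  case 0
  then show ?case using step[of "c 0" 0] zero by simp
next
  case (Suc m)
  have "(\<Sum>i\<le>Suc m. c i * Q ^ i) = c 0 + (\<Sum>i\<le>m. c (Suc i) * Q ^ i) * Q"
    by (simp add: sum.atMost_Suc_shift sum_distrib_right sum_distrib_left mult_ac del: sum.atMost_Suc)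
  then have "val (\<Sum>i\<le>Suc m. c i * Q ^ i) = min (u (c 0)) (\<mu> + val (\<Sum>i\<le>m. c (Suc i) * Q ^ i))"
    using Suc.prems by (simp add: step)
  also have "val (\<Sum>i\<le>m. c (Suc i) * Q ^ i) = Min ((\<lambda>i. u (c (Suc i)) + nat_mult i \<mu>) ` {..m})"
    using Suc.prems by (intro Suc.IH) auto
  also have "\<mu> + \<dots> = Min ((\<lambda>i. u (c (Suc i)) + nat_mult (Suc i) \<mu>) ` {..m})"
    by (simp add: add_Min_atMost add_ac)
  finally show ?case by (simp add: Min_atMost_Suc)
qed

lemma expansion_exists:
  fixes Q g :: "'k::field poly"
  assumes Q: "pdeg Q > 0" and "g \<noteq> 0"
  obtains m c where "\<forall>i\<le>m. pdeg (c i) < pdeg Q" "g = (\<Sum>i\<le>m. c i * Q ^ i)" "c m \<noteq> 0"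
proof -
  have "\<exists>m c. (\<forall>i\<le>m. pdeg (c i) < pdeg Q) \<and> g = (\<Sum>i\<le>m. c i * Q ^ i) \<and> c m \<noteq> 0"
    using \<open>g \<noteq> 0\<close>
  proof (induction "pdeg g" arbitrary: g rule: less_induct)
    case less
    show ?case
    proof (cases "pdeg g < pdeg Q")
      case True
      then show ?thesis using less.prems by (intro exI[of _ 0] exI[of _ "\<lambda>_. g"]) auto
    next
      case False
      then have "g div Q \<noteq> 0" using less.prems Q by (auto simp: div_poly_eq_0_iff)
      moreover have "pdeg (g div Q) < pdeg g" using False Q less.prems by (intro degree_div_less) auto
      ultimately obtain m c where c: "\<forall>i\<le>m. pdeg (c i) < pdeg Q"
        "g div Q = (\<Sum>i\<le>m. c i * Q ^ i)" "c m \<noteq> 0"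
        using less.hyps by blast
      define c' where "c' = (\<lambda>i. case i of 0 \<Rightarrow> g mod Q | Suc i \<Rightarrow> c i)"
      have "(\<Sum>i\<le>Suc m. c' i * Q ^ i) = g mod Q + (\<Sum>i\<le>m. c i * Q ^ i) * Q"
        by (simp add: sum.atMost_Suc_shift sum_distrib_right sum_distrib_left mult_ac c'_def del: sum.atMost_Suc)
      also have "\<dots> = g" by (simp flip: c(2))
      finally have "g = (\<Sum>i\<le>Suc m. c' i * Q ^ i)" by simp
      moreover have "\<forall>i\<le>Suc m. pdeg (c' i) < pdeg Q"
        using c(1) degree_mod_lt[OF Q] by (auto simp: c'_def split: nat.split)
      moreover have "c' (Suc m) \<noteq> 0" using c(3) by (simp add: c'_def)
      ultimately show ?thesis by blast
    qed
  qed
  then show ?thesis using that by blast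
qed

lemma expansion_degree_lt:
  fixes Q :: "'k::field poly"
  assumes "\<And>i. i < m \<Longrightarrow> pdeg (c i) < pdeg Q" "m > 0"
  shows "pdeg (\<Sum>i<m. c i * Q ^ i) < m * pdeg Q"
  using assms
proof (induction m)
  case (Suc m)
  have Q: "pdeg Q > 0" using Suc.prems(1)[of 0] by simp
  have "pdeg (c m * Q ^ m) \<le> pdeg (c m) + m * pdeg Q"
    using degree_mult_le[of "c m" "Q ^ m"] degree_power_le[of Q m] by (simp add: mult.commute)
  also have "\<dots> < Suc m * pdeg Q" using Suc.prems(1)[of m] by simp
  finally have top: "pdeg (c m * Q ^ m) < Suc m * pdeg Q" .
  show ?case
  proof (cases "m = 0")
    case True
    then show ?thesis using top by simp
  next
    case False
    then have "pdeg (\<Sum>i<m. c i * Q ^ i) < m * pdeg Q" using Suc by simp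
    then show ?thesis using top Q by (simp add: degree_add_less)
  qed
qed simp

lemma expansion_degree:
  fixes Q :: "'k::field poly"
  assumes c: "\<forall>i\<le>m. pdeg (c i) < pdeg Q" "c m \<noteq> 0"
  shows "pdeg (\<Sum>i\<le>m. c i * Q ^ i) = pdeg (c m) + m * pdeg Q"
proof -
  have "Q \<noteq> 0" using c(1) by auto
  then have top: "pdeg (c m * Q ^ m) = pdeg (c m) + m * pdeg Q"
    using c(2) by (simp add: degree_mult_eq degree_power_eq)
  show ?thesis
  proof (cases "m = 0")
    case False
    then have "pdeg (\<Sum>i<m. c i * Q ^ i) < m * pdeg Q"
      using c(1) by (intro expansion_degree_lt) auto
    then show ?thesis using top
      by (simp add: degree_add_eq_right lessThan_Suc_atMost[symmetric])
  qed (use top in simp)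
qed

locale poly_value = ring_value u
  for u :: "'k::field poly \<Rightarrow> 'g::linordered_ab_group_add with_infty"
begin

text \<open>\<open>residue_stable Q\<close> is the property of a key polynomial that makes its truncation multiplicative:
  reducing a product of two short polynomials modulo \<open>Q\<close> does not change its value.\<close>
definition residue_stable :: "'k poly \<Rightarrow> bool" where
  "residue_stable Q \<longleftrightarrow> lead_coeff Q = 1 \<and> pdeg Q > 0 \<and>
     (\<forall>a b. pdeg a < pdeg Q \<longrightarrow> pdeg b < pdeg Q \<longrightarrow> u (a * b mod Q) = u (a * b))"

abbreviation trunc :: "'k poly \<Rightarrow> 'k poly \<Rightarrow> 'g with_infty" where
  "trunc \<equiv> truncation u"

lemma trunc_low: "pdeg g < pdeg Q \<Longrightarrow> trunc Q g = u g"
  by (simp add: truncation.simps)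

lemma trunc_0 [simp]: "trunc Q 0 = Infty"
  by (simp add: truncation.simps)

lemma trunc_rec:
  assumes "pdeg Q > 0"
  shows "trunc Q g = min (u (g mod Q)) (u Q + trunc Q (g div Q))"
  using assms by (subst truncation.simps) (auto simp: mod_poly_less div_poly_less)

lemma trunc_step:
  assumes "pdeg c < pdeg Q"
  shows "trunc Q (c + h * Q) = min (u c) (u Q + trunc Q h)"
  using trunc_rec[of Q "c + h * Q"] expansion_step_div_mod[OF assms] assms by simp

lemma trunc_mult_key: "pdeg Q > 0 \<Longrightarrow> trunc Q (h * Q) = u Q + trunc Q h"
  using trunc_step[of 0 Q h] by simp

lemma trunc_key: "pdeg Q > 0 \<Longrightarrow> trunc Q Q = u Q"
  using trunc_mult_key[of Q 1] by (simp add: trunc_low)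

lemma expansion_induct [consumes 1, case_names zero step]:
  assumes "pdeg Q > 0" "P 0"
    and step: "\<And>c h. pdeg c < pdeg Q \<Longrightarrow> P h \<Longrightarrow> P (c + h * Q)"
  shows "P (g :: 'k poly)"
proof (induction "pdeg g" arbitrary: g rule: less_induct)
  case less
  have "P (g div Q)"
  proof (cases "pdeg g < pdeg Q")
    case False
    then show ?thesis using assms(1) by (intro less.hyps degree_div_less) auto
  qed (simp add: div_poly_less assms(2))
  then have "P (g mod Q + g div Q * Q)"
    using assms(1) by (intro step degree_mod_lt)
  then show ?case by simp
qed

lemma trunc_le: assumes "pdeg Q > 0" shows "trunc Q g \<le> u g"
  using assms
proof (induction g rule: expansion_induct)
  case (step c h)
  have "min (u c) (u Q + trunc Q h) \<le> min (u c) (u Q + u h)" using step by (intro min.mono add_mono) auto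
  also have "\<dots> \<le> u (c + h * Q)"
    using value_add[of c "h * Q"] by (simp add: value_mult add.commute)
  finally show ?case using step(1) by (simp add: trunc_step)
qed simp

lemma trunc_add: assumes Q: "pdeg Q > 0" shows "min (trunc Q g) (trunc Q h) \<le> trunc Q (g + h)"
  using Q
proof (induction g arbitrary: h rule: expansion_induct)
  case zero
  show ?case by simp
next
  case (step c g)
  have "trunc Q (c + g * Q + h) = trunc Q ((c + h mod Q) + (g + h div Q) * Q)"
    by (simp add: algebra_simps)
  also have "\<dots> = min (u (c + h mod Q)) (u Q + trunc Q (g + h div Q))"
    using step(1) degree_mod_lt[OF Q, of h] by (intro trunc_step) (auto simp: degree_add_less)
  finally have eq: "trunc Q (c + g * Q + h) = min (u (c + h mod Q)) (u Q + trunc Q (g + h div Q))" .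
  have "u Q + min (trunc Q g) (trunc Q (h div Q)) \<le> u Q + trunc Q (g + h div Q)"
    by (intro add_mono step.IH) auto
  then have "min (min (u c) (u (h mod Q))) (min (u Q + trunc Q g) (u Q + trunc Q (h div Q)))
      \<le> trunc Q (c + g * Q + h)"
    unfolding eq value_add_min by (intro min.mono value_add)
  then show ?case
    unfolding trunc_step[OF step(1)] trunc_rec[OF Q, of h] by (simp add: min.left_commute min.assoc)
qed

lemma trunc_1: "pdeg Q > 0 \<Longrightarrow> trunc Q 1 = 0"
  by (simp add: trunc_low)

lemma residue_stableD:
  assumes "residue_stable Q"
  shows "lead_coeff Q = 1" "pdeg Q > 0"
    "pdeg a < pdeg Q \<Longrightarrow> pdeg b < pdeg Q \<Longrightarrow> u (a * b mod Q) = u (a * b)"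
  using assms by (auto simp: residue_stable_def)

text \<open>Dividing \<open>a b\<close> by \<open>Q\<close>, the remainder has the value of \<open>a b\<close>, so the quotient
  part has at least that value.\<close>
lemma trunc_mult_low:
  assumes Q: "residue_stable Q" and "pdeg a < pdeg Q" "pdeg b < pdeg Q"
  shows "u a + u b \<le> trunc Q (a * b)"
proof -
  note Q = residue_stableD[OF Q]
  have "a * b div Q * Q = a * b - a * b mod Q" by (simp add: minus_mod_eq_div_mult)
  then have "u (a * b) \<le> u (a * b div Q * Q)"
    using Q(3)[OF assms(2,3)] by (auto intro: value_diff_ge)
  then have "u (a * b) \<le> u Q + u (a * b div Q)" by (simp add: value_mult add.commute)
  moreover have "pdeg (a * b div Q) < pdeg Q"
  proof (cases "a = 0 \<or> b = 0 \<or> a * b div Q = 0")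
    case False
    then have "pdeg (a * b div Q) + pdeg Q = pdeg (a * b div Q * Q)"
      using Q(2) by (subst degree_mult_eq) auto
    also have "\<dots> = pdeg (a * b - a * b mod Q)" by (simp add: minus_mod_eq_div_mult)
    also have "\<dots> \<le> max (pdeg a + pdeg b) (pdeg (a * b mod Q))"
      using degree_diff_le_max[of "a * b" "a * b mod Q"] degree_mult_le[of a b] by linarith
    finally show ?thesis using assms(2,3) degree_mod_lt[OF Q(2), of "a * b"] by linarith
  qed (use Q(2) in auto)
  ultimately show ?thesis
    using Q(2) Q(3)[OF assms(2,3)] by (subst trunc_rec) (auto simp: trunc_low value_mult)
qed

lemma trunc_mult_ge:
  assumes "residue_stable Q" shows "trunc Q g + trunc Q h \<le> trunc Q (g * h)"
proof -
  note Q = residue_stableD[OF assms]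
  have scalar: "u a + trunc Q h \<le> trunc Q (a * h)" if a: "pdeg a < pdeg Q" for a h
    using Q(2)
  proof (induction h rule: expansion_induct)
    case zero
    show ?case by simp
  next
    case (step c h)
    have "u a + u c \<le> trunc Q (a * c)" by (rule trunc_mult_low[OF assms a step(1)])
    moreover have "u a + (u Q + trunc Q h) \<le> trunc Q (a * h * Q)"
      using add_left_mono[OF step(2), of "u Q"] Q(2) by (simp add: trunc_mult_key add_ac)
    ultimately have "u a + min (u c) (u Q + trunc Q h) \<le> min (trunc Q (a * c)) (trunc Q (a * h * Q))"
      unfolding value_add_min by (intro min.mono)
    also have "\<dots> \<le> trunc Q (a * c + a * h * Q)" by (rule trunc_add[OF Q(2)])
    finally show ?case unfolding trunc_step[OF step(1)] by (simp add: distrib_left mult.assoc)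
  qed
  show ?thesis
    using Q(2)
  proof (induction g rule: expansion_induct)
    case zero
    show ?case by simp
  next
    case (step c g)
    have "u Q + trunc Q g + trunc Q h \<le> trunc Q (g * h * Q)"
      using add_left_mono[OF step(2), of "u Q"] Q(2) by (simp add: trunc_mult_key add_ac)
    with scalar[OF step(1), of h]
    have "min (u c + trunc Q h) (u Q + trunc Q g + trunc Q h) \<le> min (trunc Q (c * h)) (trunc Q (g * h * Q))"
      by (intro min.mono)
    also have "\<dots> \<le> trunc Q (c * h + g * h * Q)" by (rule trunc_add[OF Q(2)])
    finally show ?case unfolding trunc_step[OF step(1)]
      by (simp add: value_add_min add.commute[of _ "trunc Q h"] distrib_right distrib_left mult_ac)
  qed
qed


text \<open>If the constant term \<open>c\<close> of \<open>c + g Q\<close> has larger value than the rest, it can be dropped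
  without changing the truncated value of a product, and \<open>Q\<close> factored out. This reduces to two
  factors whose minimum is attained at the constant terms. Then the constant term of the product is
  the reduction of the product of the constant terms, and its value is the required sum.\<close>
lemma trunc_mult_le:
  assumes "residue_stable Q" shows "trunc Q (g * h) \<le> trunc Q g + trunc Q h"
proof -
  note Q = residue_stableD[OF assms]
  note ge = trunc_mult_ge[OF assms]
  have drop: "trunc Q ((c + g * Q) * h) \<le> trunc Q (c + g * Q) + trunc Q h"
    if c: "pdeg c < pdeg Q" and gt: "u Q + trunc Q g < u c"
      and IH: "trunc Q (g * h) \<le> trunc Q g + trunc Q h" for c g h
  proof (cases "trunc Q h = Infty")
    case False
    have "trunc Q g + trunc Q h = trunc Q (g * h)" using IH ge by (intro antisym)
    then have val: "trunc Q (g * h * Q) = u Q + trunc Q g + trunc Q h"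
      using Q(2) by (simp add: trunc_mult_key add.assoc)
    have "u Q + trunc Q g + trunc Q h < u c + trunc Q h"
      using gt False by (auto intro: value_add_strict_mono)
    also have "\<dots> \<le> trunc Q (c * h)" using ge[of c h] c by (simp add: trunc_low)
    finally have less: "u Q + trunc Q g + trunc Q h < trunc Q (c * h)" .
    have "trunc Q ((c + g * Q) * h) \<le> u Q + trunc Q g + trunc Q h"
    proof (rule ccontr)
      assume "\<not> ?thesis"
      then have "u Q + trunc Q g + trunc Q h < min (trunc Q ((c + g * Q) * h)) (trunc Q (- 1 * (c * h)))"
        using less ge[of "-1" "c * h"] Q(2) by (auto simp: trunc_low)
      also have "\<dots> \<le> trunc Q ((c + g * Q) * h + - 1 * (c * h))" by (rule trunc_add[OF Q(2)])
      also have "\<dots> = trunc Q (g * h * Q)" by (simp add: algebra_simps)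
      finally show False using val by simp
    qed
    then show ?thesis using gt by (simp add: trunc_step[OF c])
  qed simp
  have main: "trunc Q ((c + g * Q) * h) \<le> trunc Q (c + g * Q) + trunc Q h"
    if c: "pdeg c < pdeg Q" and IH: "\<And>h. trunc Q (g * h) \<le> trunc Q g + trunc Q h" for c g h
  proof (cases "u Q + trunc Q g < u c")
    case False
    show ?thesis using Q(2)
    proof (induction h rule: expansion_induct)
      case (step b h)
      show ?case
      proof (cases "u Q + trunc Q h < u b")
        case True
        show ?thesis
          using drop[OF step(1) True, of "c + g * Q"] step(2) by (simp add: mult.commute add.commute)
      next
        case False
        have "((c + g * Q) * (b + h * Q)) mod Q = c * b mod Q"
        proof -
          have "(c + g * Q) * (b + h * Q) = c * b + (c * h + g * b + g * h * Q) * Q"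
            by (simp add: algebra_simps)
          then show ?thesis by simp
        qed
        then have "trunc Q ((c + g * Q) * (b + h * Q)) \<le> u (c * b)"
          using trunc_rec[OF Q(2)] Q(3)[OF c step(1)] by (metis min.cobounded1)
        then show ?thesis
          using False \<open>\<not> u Q + trunc Q g < u c\<close>
          by (simp add: trunc_step c step(1) value_mult min_def not_less)
      qed
    qed simp
  qed (use c IH in \<open>auto intro: drop\<close>)
  show ?thesis
    using Q(2) by (induction g arbitrary: h rule: expansion_induct) (auto intro: main)
qed

lemma ring_value_trunc: assumes "residue_stable Q" shows "ring_value (trunc Q)"
proof
  note Q = residue_stableD[OF assms]
  show "trunc Q (g * h) = trunc Q g + trunc Q h" for g h
    by (intro antisym trunc_mult_ge trunc_mult_le assms)
  show "min (trunc Q g) (trunc Q h) \<le> trunc Q (g + h)" for g h by (rule trunc_add[OF Q(2)])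
  show "trunc Q 1 = 0" using Q(2) by (rule trunc_1)
qed simp

lemma trunc_expansion:
  assumes "\<forall>i\<le>m. pdeg (c i) < pdeg Q"
  shows "trunc Q (\<Sum>i\<le>m. c i * Q ^ i) = Min ((\<lambda>i. u (c i) + nat_mult i (u Q)) ` {..m})"
  by (intro value_expansion trunc_step assms) auto

lemma is_augmentation_trunc:
  assumes "\<And>g. pdeg g < pdeg Q \<Longrightarrow> w g = u g"
  shows "is_augmentation w Q (u Q) (trunc Q)"
  unfolding is_augmentation_def
  using trunc_expansion[of _ _ Q] assms by (auto intro!: arg_cong[where f = Min] image_cong)

lemma first_value_eq_trunc:
  assumes "\<And>a. u [:a:] = v0 a"
  shows "first_value v0 (u [:0, 1:]) = trunc [:0, 1:]"
proof
  fix g :: "'k poly"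
  have "g = (\<Sum>i\<le>pdeg g. [:pcoeff g i:] * [:0, 1:] ^ i)"
    using poly_as_sum_of_monoms[of g] by (simp add: monom_altdef)
  then have "trunc [:0, 1:] g = trunc [:0, 1:] (\<Sum>i\<le>pdeg g. [:pcoeff g i:] * [:0, 1:] ^ i)" by metis
  also have "\<dots> = Min ((\<lambda>i. u [:pcoeff g i:] + nat_mult i (u [:0, 1:])) ` {..pdeg g})"
    by (rule trunc_expansion) simp
  finally show "first_value v0 (u [:0, 1:]) g = trunc [:0, 1:] g"
    by (simp add: first_value_def assms)
qed

lemma residue_stable_linear: "residue_stable [:a, 1:]"
  unfolding residue_stable_def
proof (intro conjI allI impI)
  fix b c :: "'k poly"
  assume "pdeg b < pdeg [:a, 1:]" "pdeg c < pdeg [:a, 1:]"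
  then have "pdeg (b * c) < pdeg [:a, 1:]" using degree_mult_le[of b c] by simp
  then show "u (b * c mod [:a, 1:]) = u (b * c)" by (simp add: mod_poly_less)
qed auto

end


section \<open>Key polynomials as least-degree witnesses\<close>

lemma nat_mult_exchange:
  fixes \<gamma> \<delta> :: "'g::linordered_ab_group_add with_infty"
  assumes less: "\<gamma> < \<delta>" and fin: "\<delta> \<noteq> Infty"
    and le: "nat_mult N \<delta> + nat_mult k \<gamma> \<le> nat_mult N \<gamma> + nat_mult k \<delta>"
  shows "N \<le> k"
proof (rule ccontr)
  assume "\<not> N \<le> k"
  then obtain t where N: "N = t + k" "t > 0" by (metis add.commute less_imp_add_positive not_le)
  have "\<gamma> \<noteq> Infty" using less by auto
  then have fin': "nat_mult k \<gamma> + nat_mult k \<delta> \<noteq> Infty" using fin by simp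
  have "(nat_mult k \<gamma> + nat_mult k \<delta>) + nat_mult t \<delta> \<le> (nat_mult k \<gamma> + nat_mult k \<delta>) + nat_mult t \<gamma>"
    using le by (simp add: N nat_mult_add add_ac)
  then have "nat_mult t \<delta> \<le> nat_mult t \<gamma>" using fin' by (simp del: nat_mult_eq_Infty_iff add_eq_Infty_iff)
  then show False using nat_mult_strict_mono[OF less N(2)] by simp
qed

text \<open>In the application \<open>u\<close> is the valuation to be reached, \<open>w\<close> the current inductive value, and \<open>Q\<close> a
  monic polynomial of least degree at which they differ. That \<open>w\<close> never takes the value \<open>\<infinity>\<close> on a
  nonzero polynomial says that the chain has not ended.\<close>
locale key_step = u: poly_value u + w: poly_value w
  for u w :: "'k::field poly \<Rightarrow> 'g::linordered_ab_group_add with_infty" +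
  fixes Q :: "'k poly"
  assumes w_le: "w g \<le> u g"
    and w_finite: "g \<noteq> 0 \<Longrightarrow> w g \<noteq> Infty"
    and monic: "lead_coeff Q = 1"
    and degree_pos: "pdeg Q > 0"
    and increases: "w Q < u Q"
    and agree: "pdeg g < pdeg Q \<Longrightarrow> w g = u g"
begin

lemma Q_nonzero [simp]: "Q \<noteq> 0"
  using degree_pos by auto

lemma increases_mult: "h \<noteq> 0 \<Longrightarrow> w (h * Q) < u (h * Q)"
  using value_add_strict_mono[OF increases w_le[of h] w_finite[of h]]
  by (simp add: u.value_mult w.value_mult add.commute)

text \<open>No cancellation occurs in \<open>c + h Q\<close>: it would force \<open>w\<close> to exceed \<open>w c = u c\<close>, but \<open>u\<close> of the sum equals
  \<open>u c\<close>, because \<open>u\<close> of \<open>h Q\<close> is strictly larger than its value under \<open>w\<close>.\<close>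
lemma w_step:
  assumes c: "pdeg c < pdeg Q"
  shows "w (c + h * Q) = min (w c) (w Q + w h)"
proof (cases "h = 0")
  case False
  have hQ: "w (h * Q) = w Q + w h" by (simp add: w.value_mult add.commute)
  consider "w c < w (h * Q)" | "w (h * Q) < w c" | "w c = w (h * Q)" by fastforce
  then show ?thesis
  proof cases
    case 1
    then show ?thesis using w.value_add_eq[OF 1] hQ by simp
  next
    case 2
    then have "w (c + h * Q) = w (h * Q)" using w.value_add_eq[OF 2] by (simp add: add.commute)
    then show ?thesis using 2 hQ by (simp add: add.commute)
  next
    case 3
    have "u c < u (h * Q)" using increases_mult[OF False] 3 agree[OF c] by simp
    then have "u (c + h * Q) = w c" using u.value_add_eq agree[OF c] by simp
    then have "w (c + h * Q) \<le> w c" using w_le by metis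
    moreover have "w c \<le> w (c + h * Q)" using 3 by (intro w.value_add_ge) auto
    ultimately show ?thesis using 3 hQ by simp
  qed
qed simp

lemma w_expansion:
  assumes "\<forall>i\<le>m. pdeg (c i) < pdeg Q"
  shows "w (\<Sum>i\<le>m. c i * Q ^ i) = Min ((\<lambda>i. w (c i) + nat_mult i (w Q)) ` {..m})"
  by (intro value_expansion w_step assms) auto

text \<open>Separates the leading part of a \<open>Q\<close>-expansion: lower terms cannot cancel it in \<open>w\<close>.\<close>
lemma w_leading_ge:
  assumes "s = 0 \<or> pdeg s < j * pdeg Q"
  shows "w (r * Q ^ j + s) \<le> w (r * Q ^ j)"
  using assms
proof (induction j arbitrary: s)
  case 0
  then show ?case by simp
next
  case (Suc j)
  have div: "s div Q = 0 \<or> pdeg (s div Q) < j * pdeg Q"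
  proof (cases "s div Q = 0")
    case False
    then have "pdeg (s div Q) + pdeg Q = pdeg (s div Q * Q)" by (subst degree_mult_eq) auto
    also have "\<dots> = pdeg (s - s mod Q)" by (simp add: minus_mod_eq_div_mult)
    also have "\<dots> \<le> max (pdeg s) (pdeg (s mod Q))" by (rule degree_diff_le_max)
    finally have "pdeg (s div Q) + pdeg Q \<le> max (pdeg s) (pdeg (s mod Q))" .
    moreover have "s \<noteq> 0" using False by auto
    ultimately show ?thesis using Suc.prems degree_mod_lt[OF degree_pos, of s] by auto
  qed simp
  have "r * Q ^ Suc j + s = r * Q ^ Suc j + (s mod Q + s div Q * Q)" by simp
  also have "\<dots> = s mod Q + (r * Q ^ j + s div Q) * Q" by (simp add: algebra_simps)
  finally have eq: "w (r * Q ^ Suc j + s) = min (w (s mod Q)) (w Q + w (r * Q ^ j + s div Q))"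
    using w_step[OF degree_mod_lt[OF degree_pos, of s]] by metis
  also have "\<dots> \<le> w Q + w (r * Q ^ j)"
    using add_left_mono[OF Suc.IH[OF div], of "w Q"] by (simp add: min.coboundedI2)
  also have "\<dots> = w (r * Q ^ Suc j)" by (simp add: w.value_mult add_ac)
  finally show ?case .
qed

text \<open>By \<open>w_step\<close> the quotient part \<open>(a b div Q) Q\<close> has \<open>w\<close>-value at least that of \<open>a b\<close>, hence strictly larger
  \<open>u\<close>-value.\<close>
lemma residue_stable: "u.residue_stable Q"
  unfolding u.residue_stable_def
proof (intro conjI allI impI monic degree_pos)
  fix a b :: "'k poly"
  assume a: "pdeg a < pdeg Q" and b: "pdeg b < pdeg Q"
  have wu: "w (a * b) = u (a * b)" using agree[OF a] agree[OF b] by (simp add: u.value_mult w.value_mult)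
  have r: "w (a * b mod Q) = u (a * b mod Q)" by (intro agree degree_mod_lt degree_pos)
  show "u (a * b mod Q) = u (a * b)"
  proof (cases "a * b div Q = 0")
    case True
    then have "a * b mod Q = a * b" using div_mult_mod_eq[of "a * b" Q] by simp
    then show ?thesis by simp
  next
    case False
    have "w (a * b) \<le> w (a * b div Q * Q)"
      using w_step[OF degree_mod_lt[OF degree_pos, of "a * b"], of "a * b div Q"]
      by (simp add: w.value_mult add.commute)
    then have "u (a * b) < u (a * b div Q * Q)" using increases_mult[OF False] wu by simp
    then have "u (a * b) < u (a * b mod Q - a * b)"
      by (simp flip: minus_div_mult_eq_mod)
    then show ?thesis by (rule u.value_eq_of_diff)
  qed
qed

text \<open>This turns the graded notions into a comparison of two valuations: the polynomials
  equivalence divisible by \<open>Q\<close> are those whose value still grows. Irreducibility and minimality of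
  \<open>Q\<close> are immediate from it, the first because both valuations are multiplicative.\<close>
lemma equiv_dvd_iff:
  assumes "g \<noteq> 0"
  shows "equiv_dvd w Q g \<longleftrightarrow> w g < u g"
proof
  assume "equiv_dvd w Q g"
  then obtain a where a: "w (g - a * Q) > min (w g) (w (a * Q))"
    using w_finite[OF assms] by (auto simp: equiv_dvd_def equiv_in_def)
  have "w (a * Q) = w g"
    using a w.value_eq_of_diff[of g "a * Q"] w.value_eq_of_diff[of "a * Q" g] w.value_diff_commute[of g "a * Q"]
    by (auto simp: min_def split: if_splits)
  then have "a \<noteq> 0" "w g < w (g - a * Q)" using a w_finite[OF assms] by (auto simp: min_def)
  then have "w g < u (g - a * Q)" "w g < u (a * Q)"
    using w_le[of "g - a * Q"] increases_mult[of a] \<open>w (a * Q) = w g\<close> by auto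
  then have "w g < u (g - a * Q + a * Q)" by (rule u.value_add_gt)
  then show "w g < u g" by simp
next
  assume less: "w g < u g"
  define c h where "c = g mod Q" and "h = g div Q"
  have c: "pdeg c < pdeg Q" unfolding c_def by (intro degree_mod_lt degree_pos)
  have g: "g = c + h * Q" by (simp add: c_def h_def)
  have wg: "w g = min (w c) (w (h * Q))"
    using w_step[OF c, of h] by (simp add: g w.value_mult add.commute)
  have "w (h * Q) < w c"
  proof (rule ccontr)
    assume "\<not> ?thesis"
    then have le: "w c \<le> w (h * Q)" by simp
    then have "w g = w c" using wg by simp
    then have "c \<noteq> 0" using w_finite[OF assms] by auto
    then have "u c < u (h * Q)"
      using increases_mult[of h] le agree[OF c] w_finite by (cases "h = 0") auto
    then have "u g = w g" using u.value_add_eq[of c "h * Q"] agree[OF c] g \<open>w g = w c\<close> by simp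
    then show False using less by simp
  qed
  then have "min (w g) (w (h * Q)) < w (g - h * Q)" using wg by (simp add: g)
  then show "equiv_dvd w Q g" unfolding equiv_dvd_def equiv_in_def by blast
qed

lemma key_polynomial:
  assumes "pdeg \<phi> \<le> pdeg Q" "w \<phi> = u \<phi>"
  shows "key_polynomial w \<phi> Q (u Q)"
  unfolding key_polynomial_def
proof (intro conjI)
  have zero: "equiv_dvd w Q 0" unfolding equiv_dvd_def equiv_in_def by (intro exI[of _ 0]) simp
  show "equiv_irreducible w Q"
    unfolding equiv_irreducible_def
  proof (intro allI impI)
    fix a b assume ab: "equiv_dvd w Q (a * b)"
    show "equiv_dvd w Q a \<or> equiv_dvd w Q b"
    proof (cases "a = 0 \<or> b = 0")
      case False
      then have "w (a * b) < u (a * b)" using ab by (simp add: equiv_dvd_iff)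
      then have "w a < u a \<or> w b < u b"
        using w_le[of a] w_le[of b] by (auto simp: u.value_mult w.value_mult less_le)
      then show ?thesis using False by (simp add: equiv_dvd_iff)
    qed (use zero in auto)
  qed
  show "minimal_in w Q"
    unfolding minimal_in_def using equiv_dvd_iff agree by (metis less_irrefl not_le)
  show "\<not> equiv_in w Q \<phi>"
  proof
    assume "equiv_in w Q \<phi>"
    then have eq: "w (Q - \<phi>) > min (w Q) (w \<phi>)" using w_finite by (auto simp: equiv_in_def)
    have "w \<phi> = w Q"
      using eq w.value_eq_of_diff[of Q \<phi>] w.value_eq_of_diff[of \<phi> Q] w.value_diff_commute[of \<phi> Q]
      by (auto simp: min_def split: if_splits)
    then have "u \<phi> < u (Q - \<phi>)" using eq assms(2) w_le[of "Q - \<phi>"] by auto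
    then have "u Q = u \<phi>" by (rule u.value_eq_of_diff)
    then show False using increases assms(2) \<open>w \<phi> = w Q\<close> by simp
  qed
qed (use assms monic degree_pos increases in auto)

text \<open>The inequality says that \<open>u\<^sub>Q g - w g \<le> i (u Q - w Q)\<close>, in a form without subtraction.\<close>
lemma augmentation_bound:
  assumes c: "\<forall>i\<le>m. pdeg (c i) < pdeg Q" and "i \<le> m"
    and attained: "w (\<Sum>i\<le>m. c i * Q ^ i) = w (c i) + nat_mult i (w Q)"
  shows "u.trunc Q (\<Sum>i\<le>m. c i * Q ^ i) + nat_mult i (w Q)
    \<le> w (\<Sum>i\<le>m. c i * Q ^ i) + nat_mult i (u Q)"
proof -
  have "u.trunc Q (\<Sum>i\<le>m. c i * Q ^ i) \<le> u (c i) + nat_mult i (u Q)"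
    using \<open>i \<le> m\<close> by (simp add: u.trunc_expansion[OF c])
  then have "u.trunc Q (\<Sum>i\<le>m. c i * Q ^ i) + nat_mult i (w Q)
      \<le> w (c i) + nat_mult i (u Q) + nat_mult i (w Q)"
    using c \<open>i \<le> m\<close> agree by (simp add: add_right_mono)
  then show ?thesis by (simp add: attained add_ac)
qed

lemma attained_index:
  assumes "\<forall>i\<le>m. pdeg (c i) < pdeg Q"
  obtains i where "i \<le> m" "w (\<Sum>i\<le>m. c i * Q ^ i) = w (c i) + nat_mult i (w Q)"
proof -
  have "Min ((\<lambda>i. w (c i) + nat_mult i (w Q)) ` {..m}) \<in> (\<lambda>i. w (c i) + nat_mult i (w Q)) ` {..m}"
    by (rule Min_in) auto
  then obtain i where "i \<le> m" "w (\<Sum>i\<le>m. c i * Q ^ i) = w (c i) + nat_mult i (w Q)"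
    unfolding w_expansion[OF assms] by blast
  then show ?thesis by (rule that)
qed

text \<open>In words, \<open>f\<close> is equivalent in \<open>w\<close> to a power of \<open>Q\<close>. The hypothesis provides a multiple \<open>F = f q\<close> of \<open>f\<close>
  whose value grows, from \<open>w\<close> to the truncation at \<open>Q\<close>, as much as that of \<open>Q\<^sup>N\<close>, where
  \<open>N deg Q = deg F\<close>. By \<open>augmentation_bound\<close> this growth is at most \<open>(i + j) (u Q - w Q)\<close> for indices \<open>i\<close>, \<open>j\<close> at
  which \<open>w f\<close> and \<open>w q\<close> are attained. So \<open>N \<le> i + j\<close>, and comparing degrees gives \<open>i deg Q = deg f\<close> for
  every such \<open>i\<close>.\<close>
lemma equiv_power_of_key:
  assumes finite: "u Q \<noteq> Infty"
    and a: "a N = 1" "\<And>i. i \<le> N \<Longrightarrow> nat_mult N (u Q) \<le> u [:a i:] + nat_mult i (u Q)"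
    and dvd: "f dvd (\<Sum>i\<le>N. [:a i:] * Q ^ i)"
    and f: "lead_coeff f = 1"
  shows "\<exists>e. pdeg f = e * pdeg Q \<and> nat_mult e (w Q) < w (f - Q ^ e)"
proof -
  define F where "F = (\<Sum>i\<le>N. [:a i:] * Q ^ i)"
  have const: "\<forall>i\<le>N. pdeg [:a i:] < pdeg Q" using degree_pos by simp
  have degF: "pdeg F = N * pdeg Q" unfolding F_def using expansion_degree[OF const] a(1) by simp
  have "F \<noteq> 0"
  proof (cases "N = 0")
    case True
    then show ?thesis using a(1) by (simp add: F_def)
  next
    case False
    then show ?thesis using degF degree_pos by auto
  qed
  obtain q where q: "F = f * q" using dvd by (auto simp: F_def)
  with \<open>F \<noteq> 0\<close> have "f \<noteq> 0" "q \<noteq> 0" by auto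
  have deg_sum: "pdeg f + pdeg q = N * pdeg Q"
    using degF \<open>f \<noteq> 0\<close> \<open>q \<noteq> 0\<close> by (simp add: q degree_mult_eq)
  interpret T: ring_value "u.trunc Q" by (rule u.ring_value_trunc[OF residue_stable])
  have FT: "nat_mult N (u Q) \<le> u.trunc Q F"
    unfolding F_def u.trunc_expansion[OF const] using a(2) by simp
  have Fw: "w F \<le> nat_mult N (w Q)"
  proof -
    have "w F \<le> w [:a N:] + nat_mult N (w Q)" unfolding F_def w_expansion[OF const] by simp
    then show ?thesis by (simp add: a(1) flip: one_pCons)
  qed
  obtain m c where c: "\<forall>i\<le>m. pdeg (c i) < pdeg Q" and fe: "f = (\<Sum>i\<le>m. c i * Q ^ i)" and "c m \<noteq> 0"
    using expansion_exists[OF degree_pos \<open>f \<noteq> 0\<close>] by blast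
  obtain m' c' where c': "\<forall>i\<le>m'. pdeg (c' i) < pdeg Q" and qe: "q = (\<Sum>i\<le>m'. c' i * Q ^ i)"
    and "c' m' \<noteq> 0" using expansion_exists[OF degree_pos \<open>q \<noteq> 0\<close>] by blast
  have degf: "pdeg f = pdeg (c m) + m * pdeg Q" unfolding fe by (rule expansion_degree[OF c \<open>c m \<noteq> 0\<close>])
  have degq: "pdeg q = pdeg (c' m') + m' * pdeg Q"
    unfolding qe by (rule expansion_degree[OF c' \<open>c' m' \<noteq> 0\<close>])
  obtain j where j: "j \<le> m'" "w q = w (c' j) + nat_mult j (w Q)"
    using attained_index[OF c'] unfolding qe by blast
  \<comment> \<open>Every index attaining \<open>w f\<close> is as large as the degree of \<open>f\<close> permits, so it is unique.\<close>
  have top: "pdeg f = i * pdeg Q" if i: "i \<le> m" "w f = w (c i) + nat_mult i (w Q)" for i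
  proof -
    have "u.trunc Q f + nat_mult i (w Q) \<le> w f + nat_mult i (u Q)"
      using augmentation_bound[OF c i(1)] i(2) by (simp flip: fe)
    moreover have "u.trunc Q q + nat_mult j (w Q) \<le> w q + nat_mult j (u Q)"
      using augmentation_bound[OF c' j(1)] j(2) by (simp flip: qe)
    ultimately have "(u.trunc Q f + nat_mult i (w Q)) + (u.trunc Q q + nat_mult j (w Q))
        \<le> (w f + nat_mult i (u Q)) + (w q + nat_mult j (u Q))"
      by (rule add_mono)
    then have "u.trunc Q F + nat_mult (i + j) (w Q) \<le> w F + nat_mult (i + j) (u Q)"
      by (simp add: q T.value_mult w.value_mult nat_mult_add add_ac)
    then have "nat_mult N (u Q) + nat_mult (i + j) (w Q) \<le> nat_mult N (w Q) + nat_mult (i + j) (u Q)"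
      using add_right_mono[OF FT] add_right_mono[OF Fw] by (meson order_trans)
    then have "N \<le> i + j" by (rule nat_mult_exchange[OF increases finite])
    then have "N * pdeg Q \<le> i * pdeg Q + j * pdeg Q" by (simp flip: add_mult_distrib)
    moreover have "i * pdeg Q \<le> m * pdeg Q" "j * pdeg Q \<le> m' * pdeg Q" using i j by auto
    ultimately show ?thesis using deg_sum degf degq by linarith
  qed
  obtain i0 where "i0 \<le> m" "w f = w (c i0) + nat_mult i0 (w Q)"
    using attained_index[OF c] unfolding fe by blast
  with top[of i0] have i0: "pdeg f = i0 * pdeg Q" "i0 \<le> m" "w f = w (c i0) + nat_mult i0 (w Q)" by auto
  have "i0 = m" using i0(1,2) degf degree_pos
    by (metis le_add2 le_antisym mult_le_cancel2)
  then have "pdeg (c m) = 0" using i0 degf by simp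
  have "c m = 1"
  proof -
    obtain b where b: "c m = [:b:]" using \<open>pdeg (c m) = 0\<close> by (rule degree_eq_zeroE)
    have f': "f = (\<Sum>i<m. c i * Q ^ i) + c m * Q ^ m" by (simp add: fe lessThan_Suc_atMost[symmetric])
    have "pcoeff (\<Sum>i<m. c i * Q ^ i) (pdeg f) = 0"
    proof (cases "m = 0")
      case False
      then have "pdeg (\<Sum>i<m. c i * Q ^ i) < m * pdeg Q" using c by (intro expansion_degree_lt) auto
      then show ?thesis using i0(1) \<open>i0 = m\<close> by (simp add: coeff_eq_0)
    qed simp
    moreover have "lead_coeff (Q ^ m) = 1" by (simp add: lead_coeff_power monic)
    then have "pcoeff (Q ^ m) (pdeg f) = 1" using i0(1) \<open>i0 = m\<close> by (simp add: degree_power_eq)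
    ultimately have "lead_coeff f = b" by (subst (asm) (2) f', simp add: b) (simp add: f' b)
    then show ?thesis using f b by (simp add: one_pCons)
  qed
  then have wf: "w f = nat_mult m (w Q)" using i0 \<open>i0 = m\<close> by simp
  have "f - Q ^ m = (\<Sum>i<m. c i * Q ^ i)" by (simp add: fe \<open>c m = 1\<close> lessThan_Suc_atMost[symmetric])
  moreover have "nat_mult m (w Q) < w (\<Sum>i<m. c i * Q ^ i)"
  proof (rule w.value_sum_gt)
    show "nat_mult m (w Q) \<noteq> Infty" using increases by auto
    fix i assume "i \<in> {..<m}"
    then have "i \<le> m" "i * pdeg Q < m * pdeg Q" using degree_pos by auto
    have "w f \<le> w (c i) + nat_mult i (w Q)" using \<open>i \<le> m\<close> unfolding fe w_expansion[OF c] by simp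
    moreover have "w f \<noteq> w (c i) + nat_mult i (w Q)"
      using top[OF \<open>i \<le> m\<close>] i0(1) \<open>i0 = m\<close> \<open>i * pdeg Q < m * pdeg Q\<close> by auto
    ultimately show "nat_mult m (w Q) < w (c i * Q ^ i)"
      using wf by (simp add: w.value_mult w.value_power)
  qed
  ultimately show ?thesis using i0(1) \<open>i0 = m\<close> by metis
qed

end


section \<open>Approximate roots\<close>

text \<open>A degree bound that is stable under sums and includes the zero polynomial also for \<open>n = 0\<close>.\<close>
definition degree_below :: "nat \<Rightarrow> 'a::zero poly \<Rightarrow> bool" where
  "degree_below n p \<longleftrightarrow> (\<forall>i\<ge>n. pcoeff p i = 0)"

lemma degree_below_add:
  "degree_below n p \<Longrightarrow> degree_below n q \<Longrightarrow> degree_below n (p + q :: 'a::comm_ring poly)"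
  by (simp add: degree_below_def)

lemma degree_below_diff:
  "degree_below n p \<Longrightarrow> degree_below n q \<Longrightarrow> degree_below n (p - q :: 'a::comm_ring poly)"
  by (simp add: degree_below_def)

lemma degree_below_0 [simp]: "degree_below n 0"
  by (simp add: degree_below_def)

lemma degree_below_mono: "degree_below m p \<Longrightarrow> m \<le> n \<Longrightarrow> degree_below n p"
  by (simp add: degree_below_def)

lemma degree_belowI: "pdeg p < n \<Longrightarrow> degree_below n p"
  by (simp add: degree_below_def coeff_eq_0)

lemma degree_below_iff: "degree_below n p \<longleftrightarrow> p = 0 \<or> pdeg p < n"
  by (metis degree_belowI degree_below_0 degree_below_def leading_coeff_0_iff linorder_not_less)

lemma degree_below_mult:
  fixes p q :: "'a::idom poly"
  shows "degree_below m p \<Longrightarrow> pdeg q \<le> n \<Longrightarrow> degree_below (m + n) (q * p)"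
  by (cases "q = 0"; cases "p = 0") (auto simp: degree_below_iff degree_mult_eq)

lemma degree_below_monic_diff:
  fixes p q :: "'a::comm_ring_1 poly"
  assumes "lead_coeff p = 1" "lead_coeff q = 1" "pdeg p = n" "pdeg q = n"
  shows "degree_below n (p - q)"
  unfolding degree_below_def
proof (intro allI impI)
  fix i assume "n \<le> i"
  then show "pcoeff (p - q) i = 0" using assms by (cases "i = n") (auto simp: coeff_eq_0)
qed

text \<open>The binomial terms of \<open>(\<phi> + h)\<^sup>e\<close> beyond the linear one have degree below that of \<open>h \<phi>\<^sup>e\<^sup>-\<^sup>1\<close>; the exponent
  is written as \<open>Suc e\<close>.\<close>
lemma power_linearization_degree:
  fixes \<phi> h :: "'a::idom poly"
  assumes "pdeg h < pdeg \<phi>"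
  shows "degree_below (e * pdeg \<phi> + pdeg h)
    ((\<phi> + h) ^ Suc e - \<phi> ^ Suc e - of_nat (Suc e) * (h * \<phi> ^ e))"
proof (induction e)
  case (Suc e)
  let ?D = "\<lambda>e. (\<phi> + h) ^ Suc e - \<phi> ^ Suc e - of_nat (Suc e) * (h * \<phi> ^ e)"
  have eq: "?D (Suc e) = (\<phi> + h) * ?D e + of_nat (Suc e) * (h * (h * \<phi> ^ e))"
    by (simp add: algebra_simps)
  have "pdeg (\<phi> + h) \<le> pdeg \<phi>" using assms degree_add_le[of \<phi> "pdeg \<phi>" h] by simp
  then have "degree_below (e * pdeg \<phi> + pdeg h + pdeg \<phi>) ((\<phi> + h) * ?D e)"
    by (intro degree_below_mult Suc.IH)
  moreover have "degree_below (Suc e * pdeg \<phi> + pdeg h) (of_nat (Suc e) * (h * (h * \<phi> ^ e)))"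
  proof (rule degree_belowI)
    have "pdeg (of_nat (Suc e) * (h * (h * \<phi> ^ e))) \<le> pdeg h + (pdeg h + pdeg (\<phi> ^ e))"
      using degree_mult_le[of "of_nat (Suc e)" "h * (h * \<phi> ^ e)"] degree_mult_le[of h "h * \<phi> ^ e"]
        degree_mult_le[of h "\<phi> ^ e"] by (simp only: degree_of_nat)
    also have "\<dots> \<le> pdeg h + (pdeg h + e * pdeg \<phi>)" using degree_power_le[of \<phi> e] by (simp add: mult.commute)
    also have "\<dots> < Suc e * pdeg \<phi> + pdeg h" using assms by simp
    finally show "pdeg (of_nat (Suc e) * (h * (h * \<phi> ^ e))) < Suc e * pdeg \<phi> + pdeg h" .
  qed
  ultimately show ?case unfolding eq by (intro degree_below_add) (auto simp: add_ac)
qed simp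

text \<open>Approximate roots in the sense of Abhyankar and Moh. For \<open>e = 1\<close> the condition says \<open>f = \<psi>\<close>.\<close>
definition approximate_root :: "nat \<Rightarrow> 'a::comm_ring_1 poly \<Rightarrow> 'a poly \<Rightarrow> bool" where
  "approximate_root e f \<psi> \<longleftrightarrow> lead_coeff \<psi> = 1 \<and> pdeg f = e * pdeg \<psi> \<and>
     degree_below ((e - 1) * pdeg \<psi>) (f - \<psi> ^ e)"

lemma degree_monic_power:
  fixes \<phi> :: "'a::idom poly"
  assumes "lead_coeff \<phi> = 1"
  shows "lead_coeff (\<phi> ^ n) = 1" "pdeg (\<phi> ^ n) = n * pdeg \<phi>" "pcoeff (\<phi> ^ n) (n * pdeg \<phi>) = 1"
proof -
  have "\<phi> \<noteq> 0" using assms by auto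
  then show deg: "pdeg (\<phi> ^ n) = n * pdeg \<phi>" by (simp add: degree_power_eq)
  show lead: "lead_coeff (\<phi> ^ n) = 1" by (simp only: lead_coeff_power assms power_one)
  show "pcoeff (\<phi> ^ n) (n * pdeg \<phi>) = 1" using lead by (simp only: deg)
qed

text \<open>\<open>\<psi>\<^sup>e - \<chi>\<^sup>e\<close> factors as \<open>\<psi> - \<chi>\<close> times a polynomial with leading coefficient \<open>e\<close> and degree
  \<open>(e - 1) deg \<chi>\<close>, which is too large a degree unless \<open>\<psi> = \<chi>\<close>.\<close>
lemma approximate_root_unique:
  fixes f :: "'a::idom poly"
  assumes \<psi>: "approximate_root e f \<psi>" and \<chi>: "approximate_root e f \<chi>"
    and e: "of_nat e \<noteq> (0 :: 'a)"
  shows "\<psi> = \<chi>"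
proof (rule ccontr)
  assume "\<psi> \<noteq> \<chi>"
  have "e > 0" using e by (cases e) auto
  then have d: "pdeg \<psi> = pdeg \<chi>" using \<psi> \<chi> by (auto simp: approximate_root_def)
  let ?N = "(e - 1) * pdeg \<chi>"
  let ?S = "\<Sum>i<e. \<chi> ^ (e - Suc i) * \<psi> ^ i"
  have "pcoeff ?S ?N = (\<Sum>i<e. 1)"
    unfolding coeff_sum
  proof (rule sum.cong[OF refl])
    fix i assume "i \<in> {..<e}"
    then have "e - Suc i + i = e - 1" by auto
    then have "pdeg (\<chi> ^ (e - Suc i)) + pdeg (\<psi> ^ i) = ?N"
      using \<psi> \<chi> d by (simp add: approximate_root_def degree_monic_power flip: add_mult_distrib)
    then show "pcoeff (\<chi> ^ (e - Suc i) * \<psi> ^ i) ?N = 1"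
      using coeff_mult_degree_sum[of "\<chi> ^ (e - Suc i)" "\<psi> ^ i"] \<psi> \<chi>
      by (simp add: approximate_root_def degree_monic_power)
  qed
  then have S: "pcoeff ?S ?N \<noteq> 0" using e by simp
  then have "?S \<noteq> 0" "pdeg ?S \<ge> ?N" by (auto intro: le_degree)
  then have "\<not> degree_below ?N ((\<psi> - \<chi>) * ?S)"
    using \<open>\<psi> \<noteq> \<chi>\<close> by (simp add: degree_below_iff degree_mult_eq)
  moreover have "(\<psi> - \<chi>) * ?S = (f - \<chi> ^ e) - (f - \<psi> ^ e)"
    by (simp add: power_diff_sumr2)
  moreover have "degree_below ?N ((f - \<chi> ^ e) - (f - \<psi> ^ e))"
    using \<psi> \<chi> d by (intro degree_below_diff[of _ "f - \<chi> ^ e"]) (simp_all add: approximate_root_def)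
  ultimately show False by simp
qed

text \<open>If \<open>r\<close> is the coefficient of \<open>\<phi>\<^sup>e\<^sup>-\<^sup>1\<close> in the \<open>\<phi>\<close>-expansion of \<open>f - \<phi>\<^sup>e\<close>, then replacing \<open>\<phi>\<close> by \<open>\<phi> + r/e\<close> cancels
  the leading part \<open>r \<phi>\<^sup>e\<^sup>-\<^sup>1\<close> of \<open>f - \<phi>\<^sup>e\<close> and lowers its degree. Any property preserved by
  this Tschirnhausen transformation therefore passes from the starting polynomial to the
  approximate root. The two properties of interest are having coefficients in a subring that
  contains \<open>1/e\<close>, and being equivalent to a key polynomial.\<close>
lemma approximate_root_invariant:
  fixes f :: "'k::field poly"
  assumes e: "of_nat e \<noteq> (0 :: 'k)" and f: "lead_coeff f = 1" "pdeg f = e * d"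
    and start: "P \<phi>" "lead_coeff \<phi> = 1" "pdeg \<phi> = d" "d > 0"
    and step: "\<And>\<phi>. P \<phi> \<Longrightarrow> lead_coeff \<phi> = 1 \<Longrightarrow> pdeg \<phi> = d \<Longrightarrow>
      P (\<phi> + smult (1 / of_nat e) ((f - \<phi> ^ e) div \<phi> ^ (e - 1)))"
  obtains \<psi> where "P \<psi>" "approximate_root e f \<psi>" "pdeg \<psi> = d"
proof -
  obtain e' where e': "e = Suc e'" using e by (cases e) auto
  have "\<exists>\<psi>. P \<psi> \<and> approximate_root e f \<psi> \<and> pdeg \<psi> = d"
    if "P \<phi>" "lead_coeff \<phi> = 1" "pdeg \<phi> = d" "degree_below N (f - \<phi> ^ e)" "N \<le> e * d" for N \<phi>
    using that
  proof (induction N arbitrary: \<phi>)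
    case 0
    then show ?case using f by (intro exI[of _ \<phi>]) (auto simp: approximate_root_def intro: degree_below_mono)
  next
    case (Suc N)
    show ?case
    proof (cases "Suc N \<le> e' * d")
      case True
      then show ?thesis using Suc.prems f
        by (intro exI[of _ \<phi>]) (auto simp: approximate_root_def e' intro: degree_below_mono)
    next
      case False
      define r where "r = (f - \<phi> ^ e) div \<phi> ^ e'"
      define h where "h = smult (1 / of_nat e) r"
      have pow: "pdeg (\<phi> ^ e') = e' * d" "\<phi> ^ e' \<noteq> 0"
        using degree_monic_power[OF Suc.prems(2), of e'] Suc.prems(2,3) by auto
      have degr: "r = 0 \<or> pdeg r + e' * d \<le> N"
      proof (cases "r = 0")
        case False
        then have "pdeg r + e' * d = pdeg (r * \<phi> ^ e')" using pow by (simp add: degree_mult_eq)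
        also have "r * \<phi> ^ e' = (f - \<phi> ^ e) - (f - \<phi> ^ e) mod \<phi> ^ e'"
          by (simp add: r_def minus_mod_eq_div_mult)
        also have "degree_below (Suc N) \<dots>"
        proof (rule degree_below_diff[OF Suc.prems(4)])
          show "degree_below (Suc N) ((f - \<phi> ^ e) mod \<phi> ^ e')"
            using degree_mod_less[OF pow(2), of "f - \<phi> ^ e"] pow(1) \<open>\<not> Suc N \<le> e' * d\<close>
            by (auto simp: degree_below_iff)
        qed
        then have "pdeg ((f - \<phi> ^ e) - (f - \<phi> ^ e) mod \<phi> ^ e') \<le> N"
          by (auto simp: degree_below_iff)
        finally show ?thesis by simp
      qed simp
      then have degh: "pdeg h + e' * d \<le> N" using False e by (auto simp: h_def)
      then have hd: "pdeg h < pdeg \<phi>" using Suc.prems(3,5) by (simp add: e')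
      let ?\<phi> = "\<phi> + h"
      have monic': "pdeg ?\<phi> = d" "lead_coeff ?\<phi> = 1"
        using hd Suc.prems(2,3) by (simp_all add: degree_add_eq_left coeff_eq_0)
      have "of_nat (Suc e') * (h * \<phi> ^ e') = r * \<phi> ^ e'"
        using e by (simp add: h_def e' of_nat_poly del: of_nat_Suc)
      \<comment> \<open>The linear term of \<open>(\<phi> + h)\<^sup>e\<close> is exactly the leading part to be removed.\<close>
      then have "f - ?\<phi> ^ e = (f - \<phi> ^ e) mod \<phi> ^ e'
          - (?\<phi> ^ Suc e' - \<phi> ^ Suc e' - of_nat (Suc e') * (h * \<phi> ^ e'))"
        unfolding r_def by (simp add: e' minus_div_mult_eq_mod[symmetric])
      also have "degree_below N \<dots>"
      proof (rule degree_below_diff)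
        show "degree_below N ((f - \<phi> ^ e) mod \<phi> ^ e')"
          using degree_mod_less[OF pow(2), of "f - \<phi> ^ e"] pow(1) False by (auto simp: degree_below_iff)
        show "degree_below N (?\<phi> ^ Suc e' - \<phi> ^ Suc e' - of_nat (Suc e') * (h * \<phi> ^ e'))"
          using power_linearization_degree[OF hd, of e'] degh Suc.prems(3)
          by (auto intro: degree_below_mono simp: add.commute)
      qed
      finally have "degree_below N (f - ?\<phi> ^ e)" .
      moreover have "P ?\<phi>" using step[OF Suc.prems(1-3)] by (simp add: h_def r_def e')
      ultimately show ?thesis using Suc.IH[of ?\<phi>] monic' Suc.prems(5) by simp
    qed
  qed
  moreover have "degree_below (e * d) (f - \<phi> ^ e)"
    using f start degree_monic_power[OF start(2), of e] by (intro degree_below_monic_diff) auto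
  ultimately show ?thesis using start that by blast
qed

locale field_subring =
  fixes A :: "'k::field set"
  assumes one_closed: "1 \<in> A"
    and diff_closed: "a \<in> A \<Longrightarrow> b \<in> A \<Longrightarrow> a - b \<in> A"
    and mult_closed: "a \<in> A \<Longrightarrow> b \<in> A \<Longrightarrow> a * b \<in> A"
begin

lemma zero_closed: "0 \<in> A"
  using diff_closed[OF one_closed one_closed] by simp

lemma minus_closed: "a \<in> A \<Longrightarrow> - a \<in> A"
  using diff_closed[OF zero_closed] by fastforce

lemma add_closed: "a \<in> A \<Longrightarrow> b \<in> A \<Longrightarrow> a + b \<in> A"
  using diff_closed[OF _ minus_closed, of a b] by simp

lemma sum_closed: "(\<And>i. i \<in> I \<Longrightarrow> h i \<in> A) \<Longrightarrow> sum h I \<in> A"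
  by (induction I rule: infinite_finite_induct) (auto intro: zero_closed add_closed)

lemma power_closed: "a \<in> A \<Longrightarrow> a ^ n \<in> A"
  by (induction n) (auto intro: one_closed mult_closed)

lemma polys_over_iff: "g \<in> polys_over A \<longleftrightarrow> (\<forall>i. pcoeff g i \<in> A)"
  by (simp add: polys_over_def)

lemma poly_0_closed: "0 \<in> polys_over A"
  by (simp add: polys_over_iff zero_closed)

lemma poly_1_closed: "1 \<in> polys_over A"
  by (auto simp: polys_over_iff coeff_1 zero_closed one_closed)

lemma poly_add_closed: "g \<in> polys_over A \<Longrightarrow> h \<in> polys_over A \<Longrightarrow> g + h \<in> polys_over A"
  by (simp add: polys_over_iff add_closed)

lemma poly_diff_closed: "g \<in> polys_over A \<Longrightarrow> h \<in> polys_over A \<Longrightarrow> g - h \<in> polys_over A"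
  by (simp add: polys_over_iff diff_closed)

lemma poly_mult_closed: "g \<in> polys_over A \<Longrightarrow> h \<in> polys_over A \<Longrightarrow> g * h \<in> polys_over A"
  by (simp add: polys_over_iff coeff_mult sum_closed mult_closed)

lemma poly_smult_closed: "a \<in> A \<Longrightarrow> g \<in> polys_over A \<Longrightarrow> smult a g \<in> polys_over A"
  by (simp add: polys_over_iff mult_closed)

lemma poly_monom_closed: "a \<in> A \<Longrightarrow> Polynomial.monom a n \<in> polys_over A"
  by (simp add: polys_over_iff zero_closed)

lemma poly_power_closed: "g \<in> polys_over A \<Longrightarrow> g ^ n \<in> polys_over A"
  by (induction n) (auto intro: poly_1_closed poly_mult_closed)

lemma poly_div_monic_closed:
  assumes "g \<in> polys_over A" and m: "m \<in> polys_over A" "lead_coeff m = 1"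
  shows "g div m \<in> polys_over A"
  using assms(1)
proof (induction "pdeg g" arbitrary: g rule: less_induct)
  case less
  have "m \<noteq> 0" using m(2) by auto
  show ?case
  proof (cases "pdeg g < pdeg m \<or> g = 0")
    case True
    then show ?thesis by (auto simp: div_poly_less poly_0_closed)
  next
    case False
    define t where "t = Polynomial.monom (lead_coeff g) (pdeg g - pdeg m)"
    have t: "t \<in> polys_over A"
      unfolding t_def using less.prems by (intro poly_monom_closed) (simp add: polys_over_iff)
    have quot: "g div m = t + (g - t * m) div m"
      using \<open>m \<noteq> 0\<close> by (simp add: poly_div_diff_left)
    have deg_tm: "pdeg (t * m) = pdeg g"
      using False \<open>m \<noteq> 0\<close> by (simp add: t_def degree_mult_eq degree_monom_eq)
    have "lead_coeff (t * m) = lead_coeff g"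
      unfolding lead_coeff_mult m(2) using False by (simp add: t_def degree_monom_eq)
    note tm = deg_tm this[unfolded deg_tm]
    have "degree_below (pdeg g) (g - t * m)"
      unfolding degree_below_def
    proof (intro allI impI)
      fix i assume "pdeg g \<le> i"
      then show "pcoeff (g - t * m) i = 0" using tm by (cases "i = pdeg g") (auto simp: coeff_eq_0)
    qed
    then have "(g - t * m) div m \<in> polys_over A"
      using less.hyps[of "g - t * m"] less.prems t m(1)
      by (auto simp: degree_below_iff poly_0_closed poly_diff_closed poly_mult_closed)
    then show ?thesis unfolding quot by (intro poly_add_closed t)
  qed
qed

text \<open>The transformations are started at a power of \<open>x\<close>; by uniqueness they end in \<open>\<psi>\<close>.\<close>
lemma approximate_root_over:
  assumes e: "of_nat e \<noteq> (0 :: 'k)" "1 / of_nat e \<in> A"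
    and f: "f \<in> polys_over A" "lead_coeff f = 1"
    and \<psi>: "approximate_root e f \<psi>" "pdeg \<psi> > 0"
  shows "\<psi> \<in> polys_over A"
proof -
  obtain \<chi> where "\<chi> \<in> polys_over A" "approximate_root e f \<chi>"
  proof (rule approximate_root_invariant[OF e(1) f(2), of "pdeg \<psi>" "\<lambda>g. g \<in> polys_over A"
        "Polynomial.monom 1 (pdeg \<psi>)"])
    show "pdeg f = e * pdeg \<psi>" using \<psi> by (simp add: approximate_root_def)
    fix \<phi> assume "\<phi> \<in> polys_over A" "lead_coeff \<phi> = 1"
    then show "\<phi> + smult (1 / of_nat e) ((f - \<phi> ^ e) div \<phi> ^ (e - 1)) \<in> polys_over A"
      using f e degree_monic_power
      by (intro poly_add_closed poly_smult_closed poly_div_monic_closed poly_diff_closed poly_power_closed) auto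
  qed (use \<psi> in \<open>auto simp: degree_monom_eq intro: poly_monom_closed one_closed\<close>)
  then show ?thesis using approximate_root_unique[OF \<psi>(1) _ e(1)] by blast
qed

end

context key_step
begin

text \<open>Equivalent monic polynomials of the same degree are interchangeable as key polynomials.\<close>
lemma key_step_equiv:
  assumes "w Q < w (\<phi> - Q)" "lead_coeff \<phi> = 1" "pdeg \<phi> = pdeg Q"
  shows "key_step u w \<phi>"
proof
  have "w \<phi> = w Q" using assms(1) by (rule w.value_eq_of_diff)
  moreover have "w Q < u (\<phi> - Q + Q)"
    using assms(1) increases w_le[of "\<phi> - Q"] by (intro u.value_add_gt) auto
  ultimately show "w \<phi> < u \<phi>" by simp
qed (use assms w_le w_finite agree degree_pos in auto)

text \<open>With \<open>f\<close> equivalent to \<open>\<phi>\<^sup>e\<close>, the leading part \<open>r \<phi>\<^sup>e\<^sup>-\<^sup>1\<close> of \<open>f - \<phi>\<^sup>e\<close> has value above \<open>w (\<phi>\<^sup>e)\<close>, so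
  \<open>w r > w \<phi>\<close> and the correction \<open>r/e\<close> does not change the equivalence class of \<open>\<phi>\<close>.\<close>
lemma approximate_root_equiv:
  assumes e: "of_nat e \<noteq> (0 :: 'k)" "0 \<le> w [:1 / of_nat e:]"
    and f: "lead_coeff f = 1" "pdeg f = e * pdeg Q"
    and power: "nat_mult e (w Q) < w (f - Q ^ e)"
  obtains \<psi> where "w Q < w (\<psi> - Q)" "approximate_root e f \<psi>" "pdeg \<psi> = pdeg Q"
proof (rule approximate_root_invariant[OF e(1) f, of "\<lambda>\<phi>. w Q < w (\<phi> - Q)" Q])
  have "e > 0" using e by (cases e) auto
  fix \<phi> assume \<phi>: "w Q < w (\<phi> - Q)" "lead_coeff \<phi> = 1" "pdeg \<phi> = pdeg Q"
  interpret k: key_step u w \<phi> using key_step_equiv[OF \<phi>] .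
  define r where "r = (f - \<phi> ^ e) div \<phi> ^ (e - 1)"
  have "w \<phi> = w Q" using \<phi>(1) by (rule w.value_eq_of_diff)
  have "nat_mult e (w Q) < w ((f - Q ^ e) - (\<phi> ^ e - Q ^ e))"
    using power w.value_power_diff_gt[OF \<phi>(1) \<open>e > 0\<close>] by (rule w.value_diff_gt)
  then have "nat_mult e (w Q) < w (f - \<phi> ^ e)" by simp
  also have "f - \<phi> ^ e = r * \<phi> ^ (e - 1) + (f - \<phi> ^ e) mod \<phi> ^ (e - 1)"
    unfolding r_def by (rule div_mult_mod_eq[symmetric])
  also have "w \<dots> \<le> w (r * \<phi> ^ (e - 1))"
  proof (rule k.w_leading_ge)
    have "\<phi> ^ (e - 1) \<noteq> 0" using k.Q_nonzero by simp
    from degree_mod_less[OF this, of "f - \<phi> ^ e"]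
    show "(f - \<phi> ^ e) mod \<phi> ^ (e - 1) = 0 \<or> pdeg ((f - \<phi> ^ e) mod \<phi> ^ (e - 1)) < (e - 1) * pdeg \<phi>"
      using degree_monic_power[OF \<phi>(2), of "e - 1"] by simp
  qed
  also have "\<dots> = nat_mult (e - 1) (w Q) + w r"
    by (simp add: w.value_mult w.value_power \<open>w \<phi> = w Q\<close> add.commute)
  finally have "nat_mult (e - 1) (w Q) + w Q < nat_mult (e - 1) (w Q) + w r"
    using \<open>e > 0\<close> by (cases e) (auto simp: add.commute)
  then have "w Q < w r" using increases by (subst (asm) value_add_less_cancel) auto
  also have "\<dots> \<le> w (smult (1 / of_nat e) r)"
    using add_right_mono[OF e(2), of "w r"] w.value_mult[of "[:1 / of_nat e:]" r] by simp
  finally have "w Q < w (\<phi> - Q + smult (1 / of_nat e) r)" using \<phi>(1) by (intro w.value_add_gt)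
  then show "w Q < w (\<phi> + smult (1 / of_nat e) ((f - \<phi> ^ e) div \<phi> ^ (e - 1)) - Q)"
    by (simp add: r_def algebra_simps)
qed (use monic degree_pos increases in auto)

end


section \<open>Chevalley's extension theorem\<close>

text \<open>Chevalley's theorem is proved for pairs of a subring \<open>B\<close> and a proper ideal \<open>I\<close> of \<open>B\<close>: a maximal pair
  consists of a valuation ring and its maximal ideal.\<close>
locale subring_ideal = field_subring B for B :: "'a::field set" +
  fixes I :: "'a set"
  assumes ideal_subset: "I \<subseteq> B"
    and ideal_zero: "0 \<in> I"
    and ideal_diff: "a \<in> I \<Longrightarrow> b \<in> I \<Longrightarrow> a - b \<in> I"
    and ideal_mult: "b \<in> B \<Longrightarrow> a \<in> I \<Longrightarrow> b * a \<in> I"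
    and ideal_proper: "1 \<notin> I"
begin

lemma ideal_minus: "a \<in> I \<Longrightarrow> - a \<in> I"
  using ideal_diff[OF ideal_zero] by fastforce

lemma ideal_add: "a \<in> I \<Longrightarrow> b \<in> I \<Longrightarrow> a + b \<in> I"
  using ideal_diff[OF _ ideal_minus, of a b] by simp

lemma ideal_sum: "(\<And>i. i \<in> S \<Longrightarrow> h i \<in> I) \<Longrightarrow> sum h S \<in> I"
  by (induction S rule: infinite_finite_induct) (auto intro: ideal_zero ideal_add)

lemma ideal_poly_iff: "g \<in> polys_over I \<longleftrightarrow> (\<forall>i. pcoeff g i \<in> I)"
  by (simp add: polys_over_def)

lemma ideal_poly_diff: "g \<in> polys_over I \<Longrightarrow> h \<in> polys_over I \<Longrightarrow> g - h \<in> polys_over I"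
  by (simp add: ideal_poly_iff ideal_diff)

lemma ideal_poly_add: "g \<in> polys_over I \<Longrightarrow> h \<in> polys_over I \<Longrightarrow> g + h \<in> polys_over I"
  by (simp add: ideal_poly_iff ideal_add)

lemma ideal_poly_mult: "g \<in> polys_over B \<Longrightarrow> h \<in> polys_over I \<Longrightarrow> g * h \<in> polys_over I"
  by (simp add: ideal_poly_iff polys_over_iff coeff_mult ideal_sum ideal_mult)

lemma ideal_poly_monom: "a \<in> I \<Longrightarrow> Polynomial.monom a n \<in> polys_over I"
  by (simp add: ideal_poly_iff ideal_zero)

lemma poly_mem_ideal: "g \<in> polys_over I \<Longrightarrow> x \<in> B \<Longrightarrow> poly g x \<in> I"
  unfolding poly_altdef
  using ideal_mult[OF power_closed] by (intro ideal_sum) (simp add: ideal_poly_iff mult.commute)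

end

definition adjoin :: "'a::field set \<Rightarrow> 'a \<Rightarrow> 'a set" where
  "adjoin S x = (\<lambda>g. poly g x) ` polys_over S"

lemma subset_adjoin: "0 \<in> S \<Longrightarrow> S \<subseteq> adjoin S x"
proof
  fix a assume "0 \<in> S" "a \<in> S"
  then have "[:a:] \<in> polys_over S" by (simp add: polys_over_def coeff_pCons split: nat.split)
  then show "a \<in> adjoin S x" unfolding adjoin_def by (intro image_eqI[of _ _ "[:a:]"]) auto
qed

lemma (in field_subring) adjoin_mem: "x \<in> adjoin A x"
proof -
  have "[:0, 1:] \<in> polys_over A"
    by (simp add: polys_over_iff coeff_pCons zero_closed one_closed split: nat.split)
  then show ?thesis unfolding adjoin_def by (intro image_eqI[of _ _ "[:0, 1:]"]) auto
qed

lemma (in subring_ideal) subring_ideal_adjoin: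
  assumes "1 \<notin> adjoin I x"
  shows "subring_ideal (adjoin B x) (adjoin I x)"
proof
  show "1 \<in> adjoin B x" using subset_adjoin[OF zero_closed] one_closed by auto
  show "0 \<in> adjoin I x" using subset_adjoin[OF ideal_zero] ideal_zero by auto
  show "a - b \<in> adjoin B x" if "a \<in> adjoin B x" "b \<in> adjoin B x" for a b
    using that poly_diff_closed unfolding adjoin_def by (auto simp: image_iff simp flip: poly_diff)
  show "a * b \<in> adjoin B x" if "a \<in> adjoin B x" "b \<in> adjoin B x" for a b
    using that poly_mult_closed unfolding adjoin_def by (auto simp: image_iff simp flip: poly_mult)
  show "a - b \<in> adjoin I x" if "a \<in> adjoin I x" "b \<in> adjoin I x" for a b
    using that ideal_poly_diff unfolding adjoin_def by (auto simp: image_iff simp flip: poly_diff)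
  show "b * a \<in> adjoin I x" if "b \<in> adjoin B x" "a \<in> adjoin I x" for a b
    using that ideal_poly_mult unfolding adjoin_def by (auto simp: image_iff simp flip: poly_mult)
  show "adjoin I x \<subseteq> adjoin B x"
    unfolding adjoin_def polys_over_def using ideal_subset by auto
qed (rule assms)

locale maximal_subring_ideal = subring_ideal +
  assumes maximal: "subring_ideal B' I' \<Longrightarrow> B \<subseteq> B' \<Longrightarrow> I \<subseteq> I' \<Longrightarrow> B' = B"
begin

text \<open>If \<open>x\<close> is not in \<open>B\<close>, the pair cannot be enlarged to \<open>B[x]\<close>, so the extended ideal \<open>I B[x]\<close> contains \<open>1\<close>.\<close>
lemma outside_imp_unit_relation:
  assumes "x \<notin> B" obtains p where "p \<in> polys_over I" "poly p x = 1"
proof -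
  have "1 \<in> adjoin I x"
  proof (rule ccontr)
    assume "1 \<notin> adjoin I x"
    then have "adjoin B x = B"
      by (intro maximal[OF subring_ideal_adjoin] subset_adjoin zero_closed ideal_zero)
    then show False using adjoin_mem[of x] assms by simp
  qed
  then show ?thesis using that by (auto simp: adjoin_def)
qed

text \<open>Clearing denominators in a relation for \<open>1/(1 - j)\<close> puts a power of \<open>1 - j\<close> into \<open>I\<close>, but such a power
  is congruent to \<open>1\<close>.\<close>
lemma one_minus_ideal_unit:
  assumes j: "j \<in> I" shows "inverse (1 - j) \<in> B"
proof (rule ccontr)
  assume "inverse (1 - j) \<notin> B"
  then obtain p where p: "p \<in> polys_over I" "poly p (inverse (1 - j)) = 1"
    by (rule outside_imp_unit_relation)
  have s: "1 - j \<in> B" "1 - j \<noteq> 0" using j ideal_subset ideal_proper by (auto intro: diff_closed one_closed)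
  have "poly (reflect_poly p) (1 - j) \<in> I"
    using p(1) s(1) by (intro poly_mem_ideal) (auto simp: ideal_poly_iff coeff_reflect_poly ideal_zero)
  then have "(1 - j) ^ pdeg p \<in> I" using p(2) by (simp add: poly_reflect_poly_nz[OF s(2)])
  moreover have "1 - (1 - j) ^ n \<in> I" for n
  proof (induction n)
    case (Suc n)
    have "1 - (1 - j) ^ Suc n = (1 - (1 - j) ^ n) + (1 - j) ^ n * j" by (simp add: algebra_simps)
    also have "\<dots> \<in> I" using Suc s(1) j by (intro ideal_add ideal_mult power_closed)
    finally show ?case .
  qed (simp add: ideal_zero)
  ultimately have "(1 - j) ^ pdeg p + (1 - (1 - j) ^ pdeg p) \<in> I" by (intro ideal_add)
  then show False using ideal_proper by simp
qed

text \<open>The relation \<open>q(1/x) = 1\<close>, multiplied by \<open>x\<^sup>m\<close> with \<open>m = deg q\<close>, expresses \<open>x\<^sup>m\<close> by lower powers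
  of \<open>x\<close>, since \<open>1 - q\<^sub>0\<close> is a unit. Substituting into the leading term of \<open>p\<close> gives a relation for \<open>x\<close> of
  smaller degree.\<close>
lemma no_minimal_relations:
  assumes p: "p \<in> polys_over I" "poly p x = 1"
    and min: "\<And>p'. p' \<in> polys_over I \<Longrightarrow> poly p' x = 1 \<Longrightarrow> pdeg p \<le> pdeg p'"
    and q: "q \<in> polys_over I" "poly q (inverse x) = 1" "pdeg q \<le> pdeg p"
    and "x \<noteq> 0"
  shows False
proof -
  let ?m = "pdeg q" and ?n = "pdeg p"
  define q0 where "q0 = pcoeff q 0"
  have q0: "q0 \<in> I" using q(1) by (simp add: q0_def ideal_poly_iff)
  have "?m > 0"
  proof (rule ccontr)
    assume "\<not> ?m > 0"
    then have "poly q (inverse x) = q0" by (auto simp: q0_def elim: degree_eq_zeroE)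
    then show False using q(2) q0 ideal_proper by simp
  qed
  define S where "S = smult (inverse (1 - q0)) (reflect_poly q - Polynomial.monom q0 ?m)"
  have Rq: "reflect_poly q \<in> polys_over I"
    using q(1) by (auto simp: ideal_poly_iff coeff_reflect_poly ideal_zero)
  have "reflect_poly q - Polynomial.monom q0 ?m \<in> polys_over I"
    by (intro ideal_poly_diff Rq ideal_poly_monom q0)
  then have S: "S \<in> polys_over I"
    using one_minus_ideal_unit[OF q0] by (simp add: S_def ideal_poly_iff ideal_mult)
  have "1 - q0 \<noteq> 0" using q0 ideal_proper by auto
  then have Sx: "poly S x = x ^ ?m"
    using q(2) by (simp add: S_def poly_monom poly_reflect_poly_nz[OF \<open>x \<noteq> 0\<close>] field_simps)
  have Sdeg: "degree_below ?m S"
    by (auto simp: degree_below_def S_def coeff_reflect_poly q0_def)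
  define a where "a = lead_coeff p"
  have a: "a \<in> I" using p(1) by (simp add: a_def ideal_poly_iff)
  define p' where "p' = p - Polynomial.monom a ?n + Polynomial.monom a (?n - ?m) * S"
  have "a \<in> B" using a ideal_subset by auto
  then have "p' \<in> polys_over I"
    unfolding p'_def using p(1) a S
    by (intro ideal_poly_add ideal_poly_diff ideal_poly_mult ideal_poly_monom poly_monom_closed)
  moreover have "poly p' x = 1"
    using p(2) q(3) by (simp add: p'_def poly_monom Sx flip: power_add)
  moreover have "degree_below ?n p'"
    unfolding p'_def
  proof (rule degree_below_add)
    show "degree_below ?n (p - Polynomial.monom a ?n)"
      by (auto simp: degree_below_def a_def coeff_eq_0)
    have "degree_below (?m + (?n - ?m)) (Polynomial.monom a (?n - ?m) * S)"
      by (intro degree_below_mult Sdeg degree_monom_le)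
    then show "degree_below ?n (Polynomial.monom a (?n - ?m) * S)" using q(3) by simp
  qed
  ultimately show False using min[of p'] by (auto simp: degree_below_iff)
qed

lemma valuation_property: "x \<in> B \<or> inverse x \<in> B"
proof (rule ccontr)
  assume "\<not> ?thesis"
  then have x: "x \<notin> B" "inverse x \<notin> B" by auto
  then have "x \<noteq> 0" using zero_closed by auto
  define rel where "rel = (\<lambda>y p. p \<in> polys_over I \<and> poly p y = 1)"
  have "\<exists>p. rel y p \<and> (\<forall>p'. rel y p' \<longrightarrow> pdeg p \<le> pdeg p')" if "y \<notin> B" for y
    using outside_imp_unit_relation[OF that] ex_has_least_nat[of "rel y" _ pdeg] unfolding rel_def by metis
  with x obtain p q where p: "rel x p" "\<And>p'. rel x p' \<Longrightarrow> pdeg p \<le> pdeg p'"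
    and q: "rel (inverse x) q" "\<And>p'. rel (inverse x) p' \<Longrightarrow> pdeg q \<le> pdeg p'" by meson
  show False
  proof (cases "pdeg q \<le> pdeg p")
    case True
    then show False using no_minimal_relations[of p x q] p q \<open>x \<noteq> 0\<close> by (auto simp: rel_def)
  next
    case False
    then show False using no_minimal_relations[of q "inverse x" p] p q \<open>x \<noteq> 0\<close> by (auto simp: rel_def)
  qed
qed

end

text \<open>Zorn's lemma for inclusion is applied to pairs coded as one set, the disjoint union of the subring and the ideal.\<close>
theorem chevalley_extension:
  fixes B I :: "'a::field set"
  assumes "subring_ideal B I"
  obtains W J where "subring_ideal W J" "B \<subseteq> W" "I \<subseteq> J" "\<And>x. x \<in> W \<or> inverse x \<in> W"
proof -
  define ring_part where "ring_part = (\<lambda>P :: ('a \<times> bool) set. {x. (x, True) \<in> P})"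
  define ideal_part where "ideal_part = (\<lambda>P :: ('a \<times> bool) set. {x. (x, False) \<in> P})"
  define enc where "enc = (\<lambda>(B :: 'a set) I. B \<times> {True} \<union> I \<times> {False})"
  have enc: "ring_part (enc B I) = B" "ideal_part (enc B I) = I" for B I :: "'a set"
    by (auto simp: enc_def ring_part_def ideal_part_def)
  define family where "family = {P. subring_ideal (ring_part P) (ideal_part P) \<and> enc B I \<subseteq> P}"
  have "\<exists>M\<in>family. \<forall>Y\<in>family. M \<subseteq> Y \<longrightarrow> Y = M"
  proof (rule subset_Zorn_nonempty)
    show "family \<noteq> {}" using assms by (auto simp: family_def enc intro!: exI[of _ "enc B I"])
    fix C assume "C \<noteq> {}" and chain: "subset.chain family C"
    have two: "\<exists>P\<in>C. s \<in> P \<and> t \<in> P" if "s \<in> \<Union>C" "t \<in> \<Union>C" for s t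
      using that chain unfolding subset_chain_def by blast
    have sub: "subring_ideal (ring_part P) (ideal_part P)" if "P \<in> C" for P
      using that chain by (auto simp: subset_chain_def family_def)
    have "subring_ideal (ring_part (\<Union>C)) (ideal_part (\<Union>C))"
    proof
      show "1 \<in> ring_part (\<Union>C)"
        using \<open>C \<noteq> {}\<close> sub field_subring.one_closed[OF subring_ideal.axioms(1)]
        by (fastforce simp: ring_part_def)
      show "0 \<in> ideal_part (\<Union>C)"
        using \<open>C \<noteq> {}\<close> sub subring_ideal.ideal_zero by (fastforce simp: ideal_part_def)
      show "1 \<notin> ideal_part (\<Union>C)"
        using sub subring_ideal.ideal_proper by (fastforce simp: ideal_part_def)
      show "ideal_part (\<Union>C) \<subseteq> ring_part (\<Union>C)"
        using sub subring_ideal.ideal_subset by (fastforce simp: ideal_part_def ring_part_def)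
      fix a b
      show "a - b \<in> ring_part (\<Union>C)" "a * b \<in> ring_part (\<Union>C)"
        if "a \<in> ring_part (\<Union>C)" "b \<in> ring_part (\<Union>C)"
      proof -
        obtain P where "P \<in> C" "a \<in> ring_part P" "b \<in> ring_part P"
          using two[of "(a, True)" "(b, True)"] \<open>a \<in> _\<close> \<open>b \<in> _\<close> by (auto simp: ring_part_def)
        then have "a - b \<in> ring_part P" "a * b \<in> ring_part P"
          using field_subring.diff_closed field_subring.mult_closed subring_ideal.axioms(1)[OF sub] by blast+
        then show "a - b \<in> ring_part (\<Union>C)" "a * b \<in> ring_part (\<Union>C)"
          using \<open>P \<in> C\<close> by (auto simp: ring_part_def)
      qed
      show "a - b \<in> ideal_part (\<Union>C)" if ab: "a \<in> ideal_part (\<Union>C)" "b \<in> ideal_part (\<Union>C)"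
      proof -
        obtain P where "P \<in> C" "a \<in> ideal_part P" "b \<in> ideal_part P"
          using two[of "(a, False)" "(b, False)"] ab by (auto simp: ideal_part_def)
        then have "a - b \<in> ideal_part P" using subring_ideal.ideal_diff[OF sub] by blast
        then show ?thesis using \<open>P \<in> C\<close> by (auto simp: ideal_part_def)
      qed
      show "b * a \<in> ideal_part (\<Union>C)" if ab: "b \<in> ring_part (\<Union>C)" "a \<in> ideal_part (\<Union>C)"
      proof -
        obtain P where "P \<in> C" "b \<in> ring_part P" "a \<in> ideal_part P"
          using two[of "(b, True)" "(a, False)"] ab by (auto simp: ideal_part_def ring_part_def)
        then have "b * a \<in> ideal_part P" using subring_ideal.ideal_mult[OF sub] by blast
        then show ?thesis using \<open>P \<in> C\<close> by (auto simp: ideal_part_def)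
      qed
    qed
    then show "\<Union>C \<in> family" using \<open>C \<noteq> {}\<close> chain by (fastforce simp: family_def subset_chain_def)
  qed
  then obtain M where "M \<in> family" and max: "\<And>Y. Y \<in> family \<Longrightarrow> M \<subseteq> Y \<Longrightarrow> Y = M" by blast
  then have M: "subring_ideal (ring_part M) (ideal_part M)" "enc B I \<subseteq> M" by (auto simp: family_def)
  interpret maximal_subring_ideal "ring_part M" "ideal_part M"
  proof (intro maximal_subring_ideal.intro maximal_subring_ideal_axioms.intro M(1))
    fix B' I' assume *: "subring_ideal B' I'" "ring_part M \<subseteq> B'" "ideal_part M \<subseteq> I'"
    have "M \<subseteq> enc B' I'"
    proof
      fix t assume "t \<in> M"
      then show "t \<in> enc B' I'"
        using *(2,3) by (cases t; cases "snd t") (auto simp: enc_def ring_part_def ideal_part_def)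
    qed
    moreover from this have "enc B' I' \<in> family" using M(2) *(1) by (auto simp: family_def enc)
    ultimately have "enc B' I' = M" by (intro max)
    then show "B' = ring_part M" using enc(1)[of B' I'] by simp
  qed
  show ?thesis
  proof (rule that[OF M(1) _ _ valuation_property])
    show "B \<subseteq> ring_part M" "I \<subseteq> ideal_part M"
      using M(2) by (auto simp: enc_def ring_part_def ideal_part_def)
  qed
qed


section \<open>Evaluation in an algebraic closure\<close>

lemma map_poly_to_ac_add: "map_poly to_ac (p + q) = map_poly to_ac p + map_poly to_ac q"
  by (rule poly_eqI) (simp add: coeff_map_poly)

lemma map_poly_to_ac_diff: "map_poly to_ac (p - q) = map_poly to_ac p - map_poly to_ac q"
  by (rule poly_eqI) (simp add: coeff_map_poly)

lemma map_poly_to_ac_mult: "map_poly to_ac (p * q) = map_poly to_ac p * map_poly to_ac q"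
  by (rule poly_eqI) (simp add: coeff_map_poly coeff_mult to_ac_sum)

lemma degree_map_poly_to_ac: "pdeg (map_poly to_ac p) = pdeg p"
  by (rule degree_map_poly) simp

lemma map_poly_to_ac_reflect: "map_poly to_ac (reflect_poly p) = reflect_poly (map_poly to_ac p)"
  by (rule poly_eqI) (simp add: coeff_map_poly coeff_reflect_poly degree_map_poly_to_ac)

definition ac_eval :: "'k::field alg_closure \<Rightarrow> 'k poly \<Rightarrow> 'k alg_closure" where
  "ac_eval z p = poly (map_poly to_ac p) z"

lemma ac_eval_add: "ac_eval z (p + q) = ac_eval z p + ac_eval z q"
  by (simp add: ac_eval_def map_poly_to_ac_add)

lemma ac_eval_diff: "ac_eval z (p - q) = ac_eval z p - ac_eval z q"
  by (simp add: ac_eval_def map_poly_to_ac_diff)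

lemma ac_eval_mult: "ac_eval z (p * q) = ac_eval z p * ac_eval z q"
  by (simp add: ac_eval_def map_poly_to_ac_mult)

lemma ac_eval_const [simp]: "ac_eval z [:a:] = to_ac a"
  by (cases "a = 0") (simp_all add: ac_eval_def map_poly_pCons)

lemma ac_eval_0 [simp]: "ac_eval z 0 = 0"
  by (simp add: ac_eval_def)

lemma ac_eval_1 [simp]: "ac_eval z 1 = 1"
  by (simp add: ac_eval_def)

lemma ac_eval_X [simp]: "ac_eval z [:0, 1:] = z"
  by (simp add: ac_eval_def map_poly_pCons)

lemma ac_eval_pCons: "ac_eval z (pCons a p) = to_ac a + z * ac_eval z p"
  by (cases "a = 0 \<and> p = 0") (auto simp: ac_eval_def map_poly_pCons)

lemma ac_eval_smult: "ac_eval z (smult a p) = to_ac a * ac_eval z p"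
  using ac_eval_mult[of z "[:a:]" p] by simp

lemma ac_eval_pcompose: "ac_eval z (pcompose p g) = ac_eval (ac_eval z g) p"
  by (induction p) (simp_all add: pcompose_pCons ac_eval_pCons ac_eval_add ac_eval_mult)

lemma pcompose_altdef_sum: "pcompose p g = (\<Sum>i\<le>pdeg p. [:pcoeff p i:] * g ^ i)"
proof -
  have "pdeg (map_poly (\<lambda>x. [:x:]) p) = pdeg p" by (rule degree_map_poly) simp
  then show ?thesis by (simp add: pcompose_altdef poly_altdef coeff_map_poly)
qed

section \<open>Valuations with a unique extension\<close>

lemma (in ring_value) value_sum_distinct:
  assumes "finite S" "S \<noteq> {}" "\<And>i. i \<in> S \<Longrightarrow> w (h i) \<noteq> Infty" "inj_on (\<lambda>i. w (h i)) S"
  shows "w (sum h S) \<noteq> Infty"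
proof -
  obtain i where i: "i \<in> S" "\<And>j. j \<in> S \<Longrightarrow> w (h i) \<le> w (h j)"
    using ex_is_arg_min_if_finite[OF assms(1,2), of "\<lambda>i. w (h i)"] by (auto simp: is_arg_min_linorder)
  have "w (h i) < w (sum h (S - {i}))"
  proof (rule value_sum_gt)
    fix j assume "j \<in> S - {i}"
    then show "w (h i) < w (h j)" using i assms(4) by (metis DiffE inj_onD le_less singletonI)
  qed (use assms(3) i in auto)
  then have "w (h i + sum h (S - {i})) = w (h i)" by (rule value_add_eq)
  then show ?thesis using assms(1,3) i(1) by (simp add: sum.remove)
qed

text \<open>Here \<open>u\<close> lives on \<open>K[x]\<close> rather than on \<open>K[x]/(f)\<close>. Uniqueness is stated for the preimage \<open>S\<close> in \<open>K[x]\<close> of a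
  valuation ring of the quotient: the fourth condition makes \<open>S\<close> a union of classes modulo \<open>f\<close>, the
  fifth says that one of \<open>g\<close> and \<open>1/g\<close> belongs to it, and the last that it contracts to the given
  valuation ring of \<open>K\<close>.\<close>
locale unique_extension = poly_value u
  for u :: "'k::field poly \<Rightarrow> 'g::linordered_ab_group_add with_infty" +
  fixes f :: "'k poly"
  assumes infinite_iff: "u g = Infty \<longleftrightarrow> f dvd g"
    and irreducible: "Factorial_Ring.irreducible f"
    and monic: "lead_coeff f = 1"
    and unique: "\<And>S. 1 \<in> S \<Longrightarrow> (\<And>g h. g \<in> S \<Longrightarrow> h \<in> S \<Longrightarrow> g - h \<in> S) \<Longrightarrow>
      (\<And>g h. g \<in> S \<Longrightarrow> h \<in> S \<Longrightarrow> g * h \<in> S) \<Longrightarrow>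
      (\<And>g h. g \<in> S \<Longrightarrow> f dvd g - h \<Longrightarrow> h \<in> S) \<Longrightarrow>
      (\<And>g. \<not> f dvd g \<Longrightarrow> g \<in> S \<or> (\<exists>h\<in>S. f dvd g * h - 1)) \<Longrightarrow>
      (\<And>a. [:a:] \<in> S \<longleftrightarrow> 0 \<le> u [:a:]) \<Longrightarrow> S = {g. 0 \<le> u g}"
begin

lemma f_nonzero: "f \<noteq> 0"
  using monic by auto

lemma degree_f_pos: "pdeg f > 0"
proof (rule ccontr)
  assume "\<not> pdeg f > 0"
  then have "f dvd 1" using f_nonzero by (simp add: is_unit_iff_degree)
  then show False using irreducible by (simp add: irreducible_def)
qed

lemma const_finite: "a \<noteq> 0 \<Longrightarrow> u [:a:] \<noteq> Infty"
  unfolding infinite_iff using degree_f_pos dvd_imp_degree_le[of f "[:a:]"] by auto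

lemma const_inverse: "a \<noteq> 0 \<Longrightarrow> u [:a:] + u [:1 / a:] = 0"
  using value_mult[of "[:a:]" "[:1 / a:]"] by (simp flip: one_pCons)

definition coeff_valuation_ring :: "'k set" where
  "coeff_valuation_ring = {a. 0 \<le> u [:a:]}"

sublocale O: field_subring coeff_valuation_ring
proof
  fix a b assume "a \<in> coeff_valuation_ring" "b \<in> coeff_valuation_ring"
  then show "a - b \<in> coeff_valuation_ring" "a * b \<in> coeff_valuation_ring"
    using value_diff_ge[of 0 "[:a:]" "[:b:]"] value_mult[of "[:a:]" "[:b:]"]
    by (auto simp: coeff_valuation_ring_def mult.commute)
qed (simp add: coeff_valuation_ring_def flip: one_pCons)

definition root :: "'k alg_closure" where
  "root = (SOME z. ac_eval z f = 0)"

lemma ac_eval_root: "ac_eval root f = 0"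
proof -
  have "pdeg (map_poly to_ac f) > 0" using degree_f_pos by (simp add: degree_map_poly_to_ac)
  then have "\<exists>z. ac_eval z f = 0" unfolding ac_eval_def by (rule alg_closed_imp_poly_has_root)
  then show ?thesis unfolding root_def by (rule someI_ex)
qed

text \<open>A nonzero polynomial of least degree vanishing at the root divides every other one, in particular
  the irreducible \<open>f\<close>; so it is associated to \<open>f\<close>.\<close>
lemma ac_eval_root_eq_0_iff: "ac_eval root g = 0 \<longleftrightarrow> f dvd g"
proof
  assume "f dvd g"
  then show "ac_eval root g = 0" by (auto simp: dvd_def ac_eval_mult ac_eval_root)
next
  assume g: "ac_eval root g = 0"
  define P where "P = (\<lambda>h. h \<noteq> 0 \<and> ac_eval root h = 0)"
  obtain h where h: "P h" and min: "\<And>h'. P h' \<Longrightarrow> pdeg h \<le> pdeg h'"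
    using ex_has_least_nat[of P f pdeg] f_nonzero ac_eval_root by (auto simp: P_def)
  have dvd: "h dvd g'" if "ac_eval root g' = 0" for g'
  proof (rule ccontr)
    assume "\<not> h dvd g'"
    then have "g' mod h \<noteq> 0" by (simp add: dvd_eq_mod_eq_0)
    moreover have "ac_eval root (g' mod h) = 0"
      using that h by (simp add: P_def ac_eval_diff ac_eval_mult flip: minus_div_mult_eq_mod)
    ultimately have "pdeg h \<le> pdeg (g' mod h)" by (intro min) (simp add: P_def)
    moreover have "pdeg (g' mod h) < pdeg h"
      using \<open>g' mod h \<noteq> 0\<close> h by (intro degree_mod_less') (auto simp: P_def)
    ultimately show False by simp
  qed
  obtain k where k: "f = h * k" using dvd[OF ac_eval_root] by (rule dvdE)
  have "\<not> h dvd 1"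
  proof
    assume "h dvd 1"
    then obtain t where "1 = h * t" by (rule dvdE)
    then have "ac_eval root (h * t) = 1" by (metis ac_eval_1)
    then show False using h by (simp add: P_def ac_eval_mult)
  qed
  then have "k dvd 1" using irreducible k by (auto simp: irreducible_def)
  then obtain t where "1 = k * t" by (rule dvdE)
  then have "h = f * t" by (simp add: k mult.assoc flip: \<open>1 = k * t\<close>)
  then have "f dvd h" by simp
  then show "f dvd g" using dvd[OF g] by (rule dvd_trans)
qed

lemma ac_eval_root_eq_iff: "ac_eval root g = ac_eval root h \<longleftrightarrow> f dvd g - h"
  by (simp flip: ac_eval_root_eq_0_iff add: ac_eval_diff)

lemma algebraic_relation:
  obtains p where "p \<noteq> 0" "f dvd pcompose p g"
  using alg_closure_algebraic[of "ac_eval root g"]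
  by (metis ac_eval_def ac_eval_pcompose ac_eval_root_eq_0_iff)

text \<open>The constant term of an algebraic relation of least degree is nonzero and can be solved for.\<close>
lemma inverse_mod:
  assumes "\<not> f dvd g" obtains h where "ac_eval root h = inverse (ac_eval root g)"
proof -
  let ?z = "ac_eval root g"
  have z: "?z \<noteq> 0" using assms by (simp add: ac_eval_root_eq_0_iff)
  define P where "P = (\<lambda>p. p \<noteq> 0 \<and> ac_eval ?z p = 0)"
  obtain p0 where "P p0" using algebraic_relation[of g]
    by (metis P_def ac_eval_pcompose ac_eval_root_eq_0_iff)
  then obtain p where p: "P p" and min: "\<And>p'. P p' \<Longrightarrow> pdeg p \<le> pdeg p'"
    using ex_has_least_nat[of P p0 pdeg] by auto
  obtain c q where q: "p = pCons c q" by (cases p)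
  have rel: "to_ac c + ?z * ac_eval ?z q = 0" using p by (simp add: P_def q ac_eval_pCons)
  have "c \<noteq> 0"
  proof
    assume "c = 0"
    then have "P q" using rel z p by (simp add: P_def q)
    then show False using min[of q] p by (auto simp: P_def q)
  qed
  have "?z * ac_eval root ([:- 1 / c:] * pcompose q g) = - (?z * ac_eval ?z q) / to_ac c"
    by (simp only: ac_eval_mult ac_eval_const ac_eval_pcompose to_ac_divide to_ac_minus to_ac_1) simp
  also have "- (?z * ac_eval ?z q) = to_ac c" using rel by (simp add: add_eq_0_iff2)
  finally have "?z * ac_eval root ([:- 1 / c:] * pcompose q g) = 1" using \<open>c \<noteq> 0\<close> by simp
  then show ?thesis using that by (metis inverse_unique)
qed

text \<open>Suppose \<open>z\<close>, the value of \<open>g\<close> at a root of \<open>f\<close>, is not integral over the valuation ring \<open>O\<close> of \<open>K\<close>. Then in \<open>O[1/z]\<close> the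
  ideal generated by \<open>1/z\<close> and the maximal ideal of \<open>O\<close> is proper. Chevalley's theorem gives a
  valuation ring over \<open>O\<close> in which \<open>1/z\<close> is not a unit, so that it does not contain \<open>z\<close>. By uniqueness it
  induces the valuation ring of \<open>u\<close> on \<open>K[x]/(f)\<close>, which contains the class of \<open>g\<close>.\<close>
lemma valuation_ring_integral:
  assumes g: "0 \<le> u g"
  shows "\<exists>p. lead_coeff p = 1 \<and> p \<in> polys_over coeff_valuation_ring \<and> f dvd pcompose p g"
proof (rule ccontr)
  note O_def = coeff_valuation_ring_def
  assume "\<not> ?thesis"
  then have nonintegral: "\<not> f dvd pcompose p g"
    if "lead_coeff p = 1" "p \<in> polys_over coeff_valuation_ring" for p
    using that by blast
  define z where "z = ac_eval root g"
  have "[:0, 1:] \<in> polys_over coeff_valuation_ring"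
    by (simp add: O.polys_over_iff coeff_pCons O.zero_closed O.one_closed split: nat.split)
  then have "\<not> f dvd g" using nonintegral[of "[:0, 1:]"] by (auto simp: pcompose_pCons)
  then have "z \<noteq> 0" by (simp add: z_def ac_eval_root_eq_0_iff)
  define L where "L = {p \<in> polys_over coeff_valuation_ring. 0 < u [:pcoeff p 0:]}"
  define B where "B = ac_eval (inverse z) ` polys_over coeff_valuation_ring"
  define I where "I = ac_eval (inverse z) ` L"
  \<comment> \<open>A relation \<open>q(1/z) = 1\<close> with coefficients in \<open>O\<close> and constant term in its maximal ideal, multiplied
    by a power of \<open>z\<close>, is an integral equation for \<open>z\<close> up to the unit \<open>1 - q\<^sub>0\<close>.\<close>
  have "1 \<notin> I"
  proof
    assume "1 \<in> I"
    then obtain q where q: "q \<in> L" "ac_eval (inverse z) q = 1" by (auto simp: I_def)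
    define p where "p = 1 - q"
    define b where "b = pcoeff p 0"
    have p: "p \<in> polys_over coeff_valuation_ring" "ac_eval (inverse z) p = 0"
      using q by (auto simp: p_def L_def ac_eval_diff intro: O.poly_diff_closed O.poly_1_closed)
    have "1 - [:b:] = [:pcoeff q 0:]" by (simp add: b_def p_def one_pCons)
    then have "u ([:b:] - 1) = u [:pcoeff q 0:]" by (simp only: value_diff_commute[of "[:b:]"])
    then have "u [:b:] = 0"
      using value_eq_of_diff[of 1 "[:b:]"] q(1) by (simp add: L_def)
    then have "b \<noteq> 0" by (auto simp: zero_ne_Infty[symmetric])
    then have "u [:1 / b:] = 0" using const_inverse[of b] \<open>u [:b:] = 0\<close> by simp
    define r where "r = smult (1 / b) (reflect_poly p)"
    have "lead_coeff r = 1" using \<open>b \<noteq> 0\<close> by (simp add: r_def b_def lead_coeff_smult coeff_reflect_poly)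
    moreover have "r \<in> polys_over coeff_valuation_ring"
      unfolding r_def using p(1) \<open>u [:1 / b:] = 0\<close>
      by (intro O.poly_smult_closed) (auto simp: O.polys_over_iff coeff_reflect_poly O.zero_closed, simp add: O_def)
    moreover have "f dvd pcompose r g"
    proof -
      have "ac_eval z (reflect_poly p) = 0"
        using p(2) by (simp add: ac_eval_def map_poly_to_ac_reflect poly_reflect_poly_nz[OF \<open>z \<noteq> 0\<close>])
      then show ?thesis
        by (simp flip: ac_eval_root_eq_0_iff add: ac_eval_pcompose r_def ac_eval_smult flip: z_def)
    qed
    ultimately show False using nonintegral by blast
  qed
  have "subring_ideal B I"
  proof
    show "1 \<in> B" unfolding B_def using O.poly_1_closed by (metis ac_eval_1 image_eqI)
    show "a - b \<in> B" "a * b \<in> B" if "a \<in> B" "b \<in> B" for a b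
      using that unfolding B_def
      by (auto simp: image_iff simp flip: ac_eval_diff ac_eval_mult
          intro: O.poly_diff_closed O.poly_mult_closed)
    show "I \<subseteq> B" by (auto simp: I_def B_def L_def)
    have "0 \<in> L" by (simp add: L_def O.poly_0_closed)
    then show "0 \<in> I" unfolding I_def by (metis ac_eval_0 image_eqI)
    show "a - b \<in> I" if ab: "a \<in> I" "b \<in> I" for a b
    proof -
      obtain p q where pq: "p \<in> L" "a = ac_eval (inverse z) p" "q \<in> L" "b = ac_eval (inverse z) q"
        using ab by (auto simp: I_def)
      then have "p - q \<in> L"
        using value_diff_gt[of 0 "[:pcoeff p 0:]" "[:pcoeff q 0:]"] by (simp add: L_def O.poly_diff_closed)
      then show ?thesis unfolding I_def using pq by (metis ac_eval_diff image_eqI)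
    qed
    show "b * a \<in> I" if ab: "b \<in> B" "a \<in> I" for a b
    proof -
      obtain p q where pq: "p \<in> L" "a = ac_eval (inverse z) p"
          "q \<in> polys_over coeff_valuation_ring" "b = ac_eval (inverse z) q"
        using ab by (auto simp: I_def B_def)
      have "0 < u [:pcoeff q 0:] + u [:pcoeff p 0:]"
        using pq(1,3) O.polys_over_iff[of q] by (intro add_nonneg_pos) (auto simp: L_def O_def)
      then have "q * p \<in> L"
        using pq(1,3) value_mult[of "[:pcoeff q 0:]" "[:pcoeff p 0:]"]
        by (simp add: L_def O.poly_mult_closed coeff_mult_0 mult.commute)
      then show ?thesis unfolding I_def using pq by (metis ac_eval_mult image_eqI)
    qed
  qed (rule \<open>1 \<notin> I\<close>)
  then obtain W J where WJ: "subring_ideal W J" "B \<subseteq> W" "I \<subseteq> J"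
    and val: "\<And>x. x \<in> W \<or> inverse x \<in> W" by (rule chevalley_extension) blast
  interpret W: subring_ideal W J by (rule WJ(1))
  have disjoint: "x \<notin> W" if "inverse x \<in> I" "x \<noteq> 0" for x
    using W.ideal_mult[of x "inverse x"] W.ideal_proper that WJ(3) by auto
  have const: "to_ac a \<in> W \<longleftrightarrow> 0 \<le> u [:a:]" for a
  proof
    assume "0 \<le> u [:a:]"
    then have "[:a:] \<in> polys_over coeff_valuation_ring"
      by (simp add: O.polys_over_iff coeff_pCons O.zero_closed split: nat.split) (simp add: O_def)
    then show "to_ac a \<in> W" using WJ(2) unfolding B_def by (metis ac_eval_const image_subset_iff)
  next
    assume "to_ac a \<in> W"
    show "0 \<le> u [:a:]"
    proof (rule ccontr)
      assume neg: "\<not> ?thesis"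
      then have "a \<noteq> 0" by auto
      then have "0 < u [:1 / a:]"
      proof -
        have "u [:a:] + u [:1 / a:] = 0" "u [:a:] < 0" using \<open>a \<noteq> 0\<close> neg const_inverse by auto
        then show ?thesis by (cases "u [:a:]"; cases "u [:1 / a:]") (auto simp: zero_with_infty_def add_eq_0_iff)
      qed
      then have "[:1 / a:] \<in> L"
        by (simp add: L_def O.polys_over_iff coeff_pCons O.zero_closed split: nat.split) (simp add: O_def)
      then have "inverse (to_ac a) \<in> I" unfolding I_def
        by (metis ac_eval_const image_eqI inverse_eq_divide to_ac_inverse)
      then show False using disjoint \<open>a \<noteq> 0\<close> \<open>to_ac a \<in> W\<close> by simp
    qed
  qed
  have "{h. ac_eval root h \<in> W} = {h. 0 \<le> u h}"
  proof (rule unique)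
    fix h assume "\<not> f dvd h"
    then obtain k where k: "ac_eval root k = inverse (ac_eval root h)" by (rule inverse_mod)
    have "ac_eval root (h * k) = ac_eval root 1"
      using k \<open>\<not> f dvd h\<close> by (simp add: ac_eval_mult ac_eval_root_eq_0_iff)
    then have "f dvd h * k - 1" by (simp only: ac_eval_root_eq_iff)
    then show "h \<in> {h. ac_eval root h \<in> W} \<or> (\<exists>k\<in>{h. ac_eval root h \<in> W}. f dvd h * k - 1)"
      using val[of "ac_eval root h"] k by auto
  next
    fix h k assume "h \<in> {h. ac_eval root h \<in> W}" "f dvd h - k"
    then show "k \<in> {h. ac_eval root h \<in> W}" by (simp flip: ac_eval_root_eq_iff)
  qed (auto simp: W.one_closed W.diff_closed W.mult_closed ac_eval_diff ac_eval_mult const)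
  then have "z \<in> W" using g by (auto simp: z_def)
  moreover have "[:0, 1:] \<in> L"
    using \<open>[:0, 1:] \<in> polys_over coeff_valuation_ring\<close> by (simp add: L_def)
  then have "inverse z \<in> I" unfolding I_def by (metis ac_eval_X image_eqI)
  ultimately show False using disjoint \<open>z \<noteq> 0\<close> by blast
qed

text \<open>In an algebraic relation for \<open>g\<close> modulo \<open>f\<close> the terms cannot have pairwise distinct values, as their
  sum has value \<open>\<infinity>\<close>. Two terms of equal value express a multiple of \<open>u g\<close> as a value on \<open>K\<close>.\<close>
lemma value_torsion:
  assumes "\<not> f dvd g"
  obtains m c where "m > 0" "c \<noteq> 0" "nat_mult m (u g) = u [:c:]"
proof -
  obtain p where p: "p \<noteq> 0" "f dvd pcompose p g" by (rule algebraic_relation)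
  define S where "S = {i. i \<le> pdeg p \<and> pcoeff p i \<noteq> 0}"
  define h where "h = (\<lambda>i. [:pcoeff p i:] * g ^ i)"
  have val: "u (h i) = u [:pcoeff p i:] + nat_mult i (u g)" for i
    by (simp only: h_def value_mult value_power)
  have "u g \<noteq> Infty" using assms by (simp add: infinite_iff)
  then have fin: "u (h i) \<noteq> Infty" if "i \<in> S" for i
    using that const_finite by (simp add: S_def val)
  have "finite S" by (simp add: S_def)
  have "pdeg p \<in> S" using p(1) by (simp add: S_def)
  have "sum h S = pcompose p g"
    unfolding pcompose_altdef_sum h_def by (rule sum.mono_neutral_left) (auto simp: S_def)
  then have "u (sum h S) = Infty" using p(2) by (simp add: infinite_iff)
  then have "\<not> inj_on (\<lambda>i. u (h i)) S"
    using value_sum_distinct[of S h, OF \<open>finite S\<close> _ fin] \<open>pdeg p \<in> S\<close> by auto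
  then have "\<exists>i j. i \<in> S \<and> j \<in> S \<and> i < j \<and> u (h i) = u (h j)"
    unfolding inj_on_def by (metis linorder_neqE_nat)
  then obtain i j where ij: "i \<in> S" "j \<in> S" "i < j" "u (h i) = u (h j)" by blast
  define a b where "a = pcoeff p i" and "b = pcoeff p j"
  have ab: "a \<noteq> 0" "b \<noteq> 0" using ij by (auto simp: S_def a_def b_def)
  obtain m where m: "j = i + m" "m > 0" using ij(3) less_imp_add_positive by blast
  have "(u [:b:] + nat_mult i (u g)) + u [:a / b:] = (u [:b:] + u [:a / b:]) + nat_mult i (u g)"
    by (simp only: add_ac)
  also have "u [:b:] + u [:a / b:] = u [:a:]"
    using value_mult[of "[:b:]" "[:a / b:]"] ab by simp
  also have "u [:a:] + nat_mult i (u g) = u [:b:] + (nat_mult i (u g) + nat_mult m (u g))"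
    using ij(4) by (simp add: val m(1) nat_mult_add a_def b_def)
  also have "\<dots> = (u [:b:] + nat_mult i (u g)) + nat_mult m (u g)" by (simp only: add_ac)
  finally have "(u [:b:] + nat_mult i (u g)) + u [:a / b:] = (u [:b:] + nat_mult i (u g)) + nat_mult m (u g)" .
  moreover have "u [:b:] + nat_mult i (u g) \<noteq> Infty"
    using ab const_finite assms by (simp add: infinite_iff)
  ultimately have "u [:a / b:] = nat_mult m (u g)" by (rule value_add_cancel[rotated])
  then show ?thesis using that[of m "a / b"] m(2) ab by simp
qed

text \<open>Some \<open>t = g\<^sup>m / c\<close> with \<open>c \<in> K\<close> has value \<open>0\<close>, hence satisfies an integral equation, say of degree \<open>s\<close>.
  Multiplied by \<open>c\<^sup>s\<close> it becomes a monic equation in \<open>g\<close> of degree \<open>N = m s\<close>, with coefficients as large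
  as the equation \<open>\<Prod> (y - g\<^sub>j) = 0\<close> over \<open>N\<close> conjugates of value \<open>u g\<close> would have.\<close>
lemma power_relation:
  assumes g: "\<not> f dvd g"
  obtains N a where "a N = 1" "\<And>i. i \<le> N \<Longrightarrow> nat_mult N (u g) \<le> u [:a i:] + nat_mult i (u g)"
    "f dvd (\<Sum>i\<le>N. [:a i:] * g ^ i)"
proof -
  obtain m c where mc: "m > 0" "c \<noteq> 0" "nat_mult m (u g) = u [:c:]" using value_torsion[OF g] .
  define t where "t = smult (1 / c) (g ^ m)"
  have "[:c:] * t = g ^ m" using mc(2) by (simp add: t_def)
  then have "u [:c:] + u t = u [:c:] + 0" by (metis add_0_right mc(3) value_mult value_power)
  then have "u t = 0" by (rule value_add_cancel[OF const_finite[OF mc(2)]])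
  then obtain p where p: "lead_coeff p = 1" "p \<in> polys_over coeff_valuation_ring" "f dvd pcompose p t"
    using valuation_ring_integral[of t] by auto
  define s where "s = pdeg p"
  define a where "a = (\<lambda>k. if m dvd k then pcoeff p (k div m) * c ^ (s - k div m) else 0)"
  have "a (m * s) = 1" using mc(1) p(1) by (simp add: a_def s_def)
  moreover have "nat_mult (m * s) (u g) \<le> u [:a k:] + nat_mult k (u g)" if "k \<le> m * s" for k
  proof (cases "m dvd k")
    case True
    then obtain i where i: "k = m * i" by (rule dvdE)
    with that mc(1) have "i \<le> s" by simp
    have "[:a k:] = [:pcoeff p i:] * [:c:] ^ (s - i)"
      using mc(1) by (simp add: a_def i poly_const_pow)
    then have "u [:a k:] = u [:pcoeff p i:] + nat_mult (s - i) (nat_mult m (u g))"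
      by (simp only: value_mult value_power mc(3))
    also have "\<dots> = u [:pcoeff p i:] + nat_mult (m * (s - i)) (u g)"
      by (simp only: nat_mult_mult[of "s - i" m, symmetric] mult.commute)
    finally have "u [:a k:] = u [:pcoeff p i:] + nat_mult (m * (s - i)) (u g)" .
    then have "u [:a k:] + nat_mult k (u g) = u [:pcoeff p i:] + nat_mult (m * (s - i) + m * i) (u g)"
      by (simp add: i nat_mult_add add.assoc)
    also have "m * (s - i) + m * i = m * s" using \<open>i \<le> s\<close> by (simp flip: add_mult_distrib2)
    finally have "u [:a k:] + nat_mult k (u g) = u [:pcoeff p i:] + nat_mult (m * s) (u g)" .
    moreover have "0 \<le> u [:pcoeff p i:]"
      using p(2) O.polys_over_iff[of p] by (simp add: coeff_valuation_ring_def)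
    ultimately show ?thesis by (simp add: add_increasing)
  qed (simp add: a_def)
  moreover have "(\<Sum>k\<le>m * s. [:a k:] * g ^ k) = [:c:] ^ s * pcompose p t"
  proof -
    have "(\<Sum>k\<le>m * s. [:a k:] * g ^ k) = (\<Sum>k\<in>(\<lambda>i. m * i) ` {..s}. [:a k:] * g ^ k)"
      using mc(1) by (intro sum.mono_neutral_right) (auto simp: a_def)
    also have "\<dots> = (\<Sum>i\<le>s. [:a (m * i):] * g ^ (m * i))"
      using mc(1) by (subst sum.reindex) (auto simp: inj_on_def)
    also have "\<dots> = (\<Sum>i\<le>s. [:c:] ^ s * ([:pcoeff p i:] * t ^ i))"
    proof (rule sum.cong[OF refl])
      fix i assume "i \<in> {..s}"
      then have "[:c:] ^ s = [:c:] ^ (s - i) * [:c:] ^ i" by (simp flip: power_add)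
      then have "[:c:] ^ s * ([:pcoeff p i:] * t ^ i) = [:pcoeff p i:] * [:c:] ^ (s - i) * ([:c:] * t) ^ i"
        by (simp only: power_mult_distrib mult_ac)
      also have "[:c:] * t = g ^ m" by fact
      also have "[:pcoeff p i:] * [:c:] ^ (s - i) = [:a (m * i):]"
        using mc(1) by (simp add: a_def poly_const_pow)
      finally show "[:a (m * i):] * g ^ (m * i) = [:c:] ^ s * ([:pcoeff p i:] * t ^ i)"
        by (simp add: power_mult)
    qed
    finally show ?thesis by (simp add: pcompose_altdef_sum s_def sum_distrib_left)
  qed
  then have "f dvd (\<Sum>k\<le>m * s. [:a k:] * g ^ k)" using p(3) by simp
  ultimately show ?thesis by (rule that)
qed

end


section \<open>The chain of key polynomials\<close>

locale tame_extension = unique_extension u f + A: field_subring A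
  for u :: "'k::field poly \<Rightarrow> 'g::linordered_ab_group_add with_infty" and f and A +
  assumes nonneg: "a \<in> A \<Longrightarrow> 0 \<le> u [:a:]"
    and f_over: "f \<in> polys_over A"
    and tame: "e dvd pdeg f \<Longrightarrow> of_nat e \<noteq> (0 :: 'k) \<and> 1 / of_nat e \<in> A"
begin

lemma u_finite: "pdeg g < pdeg f \<Longrightarrow> g \<noteq> 0 \<Longrightarrow> u g \<noteq> Infty"
  unfolding infinite_iff using dvd_imp_degree_le[of f g] by auto

lemma monic_infinite_eq:
  assumes "u Q = Infty" "lead_coeff Q = 1" "pdeg Q \<le> pdeg f" shows "Q = f"
proof (rule ccontr)
  assume "Q \<noteq> f"
  have "f dvd Q" using assms(1) by (simp add: infinite_iff)
  moreover have "Q \<noteq> 0" using assms(2) by auto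
  ultimately have "pdeg Q = pdeg f" using assms(3) dvd_imp_degree_le[of f Q] by (intro antisym) auto
  then have "degree_below (pdeg f) (Q - f)" by (intro degree_below_monic_diff assms monic) auto
  then have "\<not> f dvd Q - f" using \<open>Q \<noteq> f\<close> dvd_imp_degree_le[of f "Q - f"] by (auto simp: degree_below_iff)
  then show False using \<open>f dvd Q\<close> by simp
qed

lemma trunc_f: "trunc f = u"
proof
  fix g
  have "trunc f g = u (g mod f)" using trunc_rec[OF degree_f_pos, of g] infinite_iff[of f] by simp
  moreover have "u g = u (g mod f)"
  proof (cases "f dvd g")
    case False
    have "u (g - g mod f) = Infty" by (simp add: infinite_iff minus_mod_eq_mult_div)
    moreover have "u (g mod f) \<noteq> Infty" using False by (simp add: infinite_iff dvd_mod_iff)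
    ultimately show ?thesis using value_eq_of_diff[of "g mod f" g] by simp
  qed (simp add: infinite_iff)
  ultimately show "trunc f g = u g" by simp
qed

lemma trunc_finite:
  assumes "pdeg Q > 0" "pdeg Q \<le> pdeg f" "u Q \<noteq> Infty" "g \<noteq> 0"
  shows "trunc Q g \<noteq> Infty"
proof -
  have "trunc Q g = Infty \<longrightarrow> g = 0" using assms(1)
  proof (induction g rule: expansion_induct)
    case (step c h)
    have "u c = Infty \<Longrightarrow> c = 0" using u_finite[of c] step(1) assms(2) by (meson less_le_trans)
    then show ?case
      using step assms(3) by (auto simp: trunc_step min_def split: if_splits)
  qed simp
  then show ?thesis using assms(4) by simp
qed

lemma key_of_least_degree:
  assumes \<phi>: "residue_stable \<phi>" "pdeg \<phi> \<le> pdeg f" "\<phi> \<noteq> f"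
  obtains Q where "key_step u (trunc \<phi>) Q" "pdeg \<phi> \<le> pdeg Q" "pdeg Q \<le> pdeg f"
    "\<And>g. trunc \<phi> g < u g \<Longrightarrow> pdeg Q \<le> pdeg g"
proof -
  note stable = residue_stableD[OF \<phi>(1)]
  have "u \<phi> \<noteq> Infty" using monic_infinite_eq[OF _ stable(1) \<phi>(2)] \<phi>(3) by auto
  note finite = trunc_finite[OF stable(2) \<phi>(2) this]
  interpret w: ring_value "trunc \<phi>" by (rule ring_value_trunc[OF \<phi>(1)])
  define P where "P = (\<lambda>g. trunc \<phi> g < u g)"
  have "P f" using finite[of f] f_nonzero infinite_iff[of f] by (simp add: P_def)
  then obtain g where g: "P g" and min: "\<And>h. P h \<Longrightarrow> pdeg g \<le> pdeg h"
    using ex_has_least_nat[of P f pdeg] by auto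
  have low: "\<not> P h" if "pdeg h < pdeg \<phi>" for h using that by (simp add: P_def trunc_low)
  then have dg: "pdeg \<phi> \<le> pdeg g" using g by (meson not_le)
  have "g \<noteq> 0" using g by (auto simp: P_def)
  define c where "c = 1 / lead_coeff g"
  define Q where "Q = smult c g"
  have "c \<noteq> 0" using \<open>g \<noteq> 0\<close> by (simp add: c_def)
  have Q: "lead_coeff Q = 1" "pdeg Q = pdeg g" using \<open>g \<noteq> 0\<close> by (simp_all add: Q_def c_def)
  have "trunc \<phi> [:c:] = u [:c:]" using stable(2) by (simp add: trunc_low)
  then have "trunc \<phi> Q < u Q"
    using g const_finite[OF \<open>c \<noteq> 0\<close>] w.value_mult[of "[:c:]" g] value_mult[of "[:c:]" g]
    by (simp add: Q_def P_def)
  then have "key_step u (trunc \<phi>) Q"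
  proof unfold_locales
    show "trunc \<phi> h \<le> u h" for h by (rule trunc_le[OF stable(2)])
    show "trunc \<phi> h = u h" if "pdeg h < pdeg Q" for h
    proof (rule antisym[OF trunc_le[OF stable(2)]])
      show "u h \<le> trunc \<phi> h" using that min[of h] Q(2) by (auto simp: P_def not_less[symmetric])
    qed
  qed (use Q dg stable(2) finite in auto)
  then show ?thesis
    using that[of Q] dg min Q(2) \<open>P f\<close> by (simp add: P_def)
qed

text \<open>A monic \<open>Q\<close> of least degree with \<open>u\<^sub>\<phi> Q < u Q\<close> is equivalent to an approximate root of \<open>f\<close>, which
  takes its place.\<close>
lemma next_key:
  assumes \<phi>: "residue_stable \<phi>" "pdeg \<phi> \<le> pdeg f" "\<phi> \<noteq> f"
  obtains e \<psi> where "key_step u (trunc \<phi>) \<psi>" "approximate_root e f \<psi>"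
    "pdeg \<phi> \<le> pdeg \<psi>" "\<And>g. trunc \<phi> g < u g \<Longrightarrow> pdeg \<psi> \<le> pdeg g"
proof -
  obtain Q where "key_step u (trunc \<phi>) Q" and Q: "pdeg \<phi> \<le> pdeg Q" "pdeg Q \<le> pdeg f"
    "\<And>g. trunc \<phi> g < u g \<Longrightarrow> pdeg Q \<le> pdeg g" using key_of_least_degree[OF assms] by blast
  interpret Q: key_step u "trunc \<phi>" Q by fact
  have "\<exists>e. pdeg f = e * pdeg Q \<and> nat_mult e (trunc \<phi> Q) < trunc \<phi> (f - Q ^ e)"
  proof (cases "u Q = Infty")
    case True
    \<comment> \<open>Here \<open>Q = f\<close>, so the exponent is \<open>1\<close> and the difference is \<open>0\<close>.\<close>
    then have "Q = f" using Q.monic Q(2) by (rule monic_infinite_eq)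
    then show ?thesis using Q.increases by (intro exI[of _ 1]) auto
  next
    case False
    then have "\<not> f dvd Q" by (simp add: infinite_iff)
    then obtain N a where "a N = 1" "\<And>i. i \<le> N \<Longrightarrow> nat_mult N (u Q) \<le> u [:a i:] + nat_mult i (u Q)"
      "f dvd (\<Sum>i\<le>N. [:a i:] * Q ^ i)" by (rule power_relation) blast
    then show ?thesis using False monic by (intro Q.equiv_power_of_key)
  qed
  then obtain e where e: "pdeg f = e * pdeg Q" "nat_mult e (trunc \<phi> Q) < trunc \<phi> (f - Q ^ e)" by blast
  have inv: "of_nat e \<noteq> (0 :: 'k)" "1 / of_nat e \<in> A" using tame[of e] e(1) by auto
  have "0 \<le> trunc \<phi> [:1 / of_nat e:]"
    using nonneg[OF inv(2)] residue_stableD(2)[OF \<phi>(1)] by (simp add: trunc_low)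
  then obtain \<psi> where \<psi>: "trunc \<phi> Q < trunc \<phi> (\<psi> - Q)" "approximate_root e f \<psi>" "pdeg \<psi> = pdeg Q"
    using Q.approximate_root_equiv[OF inv(1) _ monic e] by blast
  then have "key_step u (trunc \<phi>) \<psi>" by (intro Q.key_step_equiv) (simp_all add: approximate_root_def)
  then show ?thesis using that \<psi> Q by metis
qed

text \<open>Saturation of the current key polynomial forces the next one to have larger degree. It can fail
  only for \<open>\<phi>\<^sub>1 = x\<close>, which need not be an approximate root of \<open>f\<close>.\<close>
definition saturated :: "'k poly \<Rightarrow> bool" where
  "saturated \<phi> \<longleftrightarrow> (\<forall>g. pdeg g \<le> pdeg \<phi> \<longrightarrow> trunc \<phi> g = u g)"

lemma approximate_root_factor_unique:
  assumes "approximate_root e f \<psi>" "approximate_root e' f \<chi>" "pdeg \<psi> = pdeg \<chi>"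
  shows "\<psi> = \<chi>"
proof -
  have "e * pdeg \<psi> = e' * pdeg \<psi>" "pdeg \<psi> > 0"
    using assms degree_f_pos by (auto simp: approximate_root_def intro!: Nat.gr0I)
  then have "e' = e" by simp
  moreover have "e dvd pdeg f" using assms by (simp add: approximate_root_def)
  ultimately show ?thesis using approximate_root_unique[OF assms(1)] assms(2) tame by blast
qed

text \<open>Otherwise the next key polynomial, which is again an approximate root of \<open>f\<close>, would have the
  degree of \<open>\<psi>\<close> and would equal \<open>\<psi>\<close>. But truncating at \<open>\<psi>\<close> does not lower the value of \<open>\<psi>\<close>.\<close>
lemma saturated_approximate_root:
  assumes \<psi>: "approximate_root e f \<psi>" "residue_stable \<psi>" "pdeg \<psi> \<le> pdeg f"
  shows "saturated \<psi>"
proof (cases "\<psi> = f")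
  case True
  then show ?thesis by (simp add: saturated_def trunc_f)
next
  case False
  then obtain e' \<chi> where \<chi>: "key_step u (trunc \<psi>) \<chi>" "approximate_root e' f \<chi>" "pdeg \<psi> \<le> pdeg \<chi>"
    "\<And>g. trunc \<psi> g < u g \<Longrightarrow> pdeg \<chi> \<le> pdeg g" using next_key[OF \<psi>(2,3)] by blast
  have "pdeg \<psi> < pdeg \<chi>"
  proof (rule ccontr)
    assume "\<not> ?thesis"
    then have "\<psi> = \<chi>" using \<chi>(3) by (intro approximate_root_factor_unique[OF \<psi>(1) \<chi>(2)]) simp
    then show False
      using key_step.increases[OF \<chi>(1)] trunc_key[OF residue_stableD(2)[OF \<psi>(2)]] by simp
  qed
  then show ?thesis
    unfolding saturated_def using \<chi>(4) trunc_le[OF residue_stableD(2)[OF \<psi>(2)]]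
    by (metis le_less leD order_le_less_trans)
qed

definition truncation_chain ::
    "('k \<Rightarrow> 'g with_infty) \<Rightarrow> nat \<Rightarrow> (nat \<Rightarrow> 'k poly) \<Rightarrow> (nat \<Rightarrow> 'k poly \<Rightarrow> 'g with_infty) \<Rightarrow> bool" where
  "truncation_chain v0 k \<phi> V \<longleftrightarrow> inductive_values v0 k \<phi> (\<lambda>i. u (\<phi> i)) V \<and>
     V k = trunc (\<phi> k) \<and> residue_stable (\<phi> k) \<and> pdeg (\<phi> k) \<le> pdeg f \<and>
     (\<forall>i\<in>{1..k}. \<phi> i \<in> polys_over A)"

lemma truncation_chain_extend:
  assumes chain: "truncation_chain v0 k \<phi> V" and "\<phi> k \<noteq> f"
  obtains \<psi> where "truncation_chain v0 (Suc k) (\<phi>(Suc k := \<psi>)) (V(Suc k := trunc \<psi>))"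
    "saturated \<psi>" "saturated (\<phi> k) \<Longrightarrow> pdeg (\<phi> k) < pdeg \<psi>"
proof -
  have ind: "inductive_values v0 k \<phi> (\<lambda>i. u (\<phi> i)) V"
    and Vk: "V k = trunc (\<phi> k)" and \<phi>: "residue_stable (\<phi> k)" "pdeg (\<phi> k) \<le> pdeg f"
    and A: "\<And>i. i \<in> {1..k} \<Longrightarrow> \<phi> i \<in> polys_over A"
    using chain by (auto simp: truncation_chain_def)
  obtain e \<psi> where "key_step u (trunc (\<phi> k)) \<psi>" and root: "approximate_root e f \<psi>"
    and deg: "pdeg (\<phi> k) \<le> pdeg \<psi>"
    using next_key[OF \<phi> \<open>\<phi> k \<noteq> f\<close>] by blast
  interpret \<psi>: key_step u "trunc (\<phi> k)" \<psi> by fact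
  have ef: "pdeg f = e * pdeg \<psi>" using root by (simp add: approximate_root_def)
  then have "e > 0" using degree_f_pos by (auto intro!: Nat.gr0I)
  then have degf: "pdeg \<psi> \<le> pdeg f" using ef by simp
  have e: "of_nat e \<noteq> (0 :: 'k)" "1 / of_nat e \<in> A" using tame[of e] ef by auto
  have over: "\<psi> \<in> polys_over A"
    by (rule A.approximate_root_over[OF e f_over monic root \<psi>.degree_pos])
  have finite: "u (\<phi> k) \<noteq> Infty"
    using monic_infinite_eq[OF _ residue_stableD(1)[OF \<phi>(1)] \<phi>(2)] \<open>\<phi> k \<noteq> f\<close> by auto
  have "key_polynomial (trunc (\<phi> k)) (\<phi> k) \<psi> (u \<psi>)"
    using deg trunc_key[OF residue_stableD(2)[OF \<phi>(1)]] by (rule \<psi>.key_polynomial)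
  moreover have "is_augmentation (trunc (\<phi> k)) \<psi> (u \<psi>) (trunc \<psi>)"
    by (rule is_augmentation_trunc[OF \<psi>.agree])
  ultimately have "inductive_values v0 (Suc k) (\<phi>(Suc k := \<psi>)) (\<lambda>i. u ((\<phi>(Suc k := \<psi>)) i)) (V(Suc k := trunc \<psi>))"
    using ind finite Vk unfolding inductive_values_def
    by (auto simp: le_Suc_eq less_Suc_eq)
  then have "truncation_chain v0 (Suc k) (\<phi>(Suc k := \<psi>)) (V(Suc k := trunc \<psi>))"
    using A over degf \<psi>.residue_stable by (auto simp: truncation_chain_def le_Suc_eq)
  moreover have "saturated \<psi>" by (rule saturated_approximate_root[OF root \<psi>.residue_stable degf])
  moreover have "pdeg (\<phi> k) < pdeg \<psi>" if "saturated (\<phi> k)"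
    using that \<psi>.increases by (auto simp: saturated_def not_le[symmetric])
  ultimately show ?thesis by (rule that)
qed

lemma truncation_chain_complete:
  assumes "truncation_chain v0 k \<phi> V" "saturated (\<phi> k)"
  shows "\<exists>n \<phi> V. truncation_chain v0 n \<phi> V \<and> \<phi> n = f"
  using assms
proof (induction "pdeg f - pdeg (\<phi> k)" arbitrary: k \<phi> V rule: less_induct)
  case less
  show ?case
  proof (cases "\<phi> k = f")
    case False
    then obtain \<psi> where *: "truncation_chain v0 (Suc k) (\<phi>(Suc k := \<psi>)) (V(Suc k := trunc \<psi>))"
      "saturated \<psi>" "pdeg (\<phi> k) < pdeg \<psi>"
      using truncation_chain_extend[OF less.prems(1)] less.prems(2) by blast
    moreover have "pdeg \<psi> \<le> pdeg f" using *(1) by (simp add: truncation_chain_def)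
    ultimately show ?thesis by (intro less.hyps[OF _ *(1)]) auto
  qed (use less.prems in blast)
qed

text \<open>The first step, from \<open>x\<close>, may keep the degree \<open>1\<close>; afterwards all key polynomials are saturated.\<close>
theorem key_polynomials_over:
  assumes v0: "\<And>a. u [:a:] = v0 a"
  shows "\<exists>n \<phi> V. inductive_values v0 n \<phi> (\<lambda>k. u (\<phi> k)) V \<and> \<phi> n = f \<and> V n = u \<and>
    (\<forall>i\<in>{1..n}. \<phi> i \<in> polys_over A)"
proof -
  let ?x = "[:0, 1:] :: 'k poly"
  have "?x \<in> polys_over A"
    by (simp add: A.polys_over_iff coeff_pCons A.zero_closed A.one_closed split: nat.split)
  then have start: "truncation_chain v0 1 (\<lambda>_. ?x) (\<lambda>_. trunc ?x)"
    using degree_f_pos residue_stable_linear[of 0] first_value_eq_trunc[OF v0]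
    by (auto simp: truncation_chain_def inductive_values_def)
  have "\<exists>n \<phi> V. truncation_chain v0 n \<phi> V \<and> \<phi> n = f"
  proof (cases "?x = f")
    case False
    then obtain \<psi> where "truncation_chain v0 (Suc 1) ((\<lambda>_. ?x)(Suc 1 := \<psi>)) ((\<lambda>_. trunc ?x)(Suc 1 := trunc \<psi>))"
      and "saturated \<psi>" using truncation_chain_extend[OF start] by blast
    from this(1) show ?thesis
      by (rule truncation_chain_complete) (simp add: \<open>saturated \<psi>\<close>)
  qed (use start in blast)
  then show ?thesis unfolding truncation_chain_def using trunc_f by metis
qed

end


section \<open>Units in local rings\<close>

lemma (in cring) nonunit_in_maximalideal:
  assumes x: "x \<in> carrier R" "x \<notin> Units R"
  obtains m where "maximalideal m R" "x \<in> m"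
proof -
  define family where "family = {I. ideal I R \<and> x \<in> I \<and> \<one> \<notin> I}"
  have "\<exists>m\<in>family. \<forall>J\<in>family. m \<subseteq> J \<longrightarrow> J = m"
  proof (rule subset_Zorn_nonempty)
    have "\<one> \<notin> PIdl x"
    proof
      assume "\<one> \<in> PIdl x"
      then obtain y where "y \<in> carrier R" "\<one> = y \<otimes> x" by (auto simp: cgenideal_def)
      then have "x \<in> Units R" using x(1) m_comm[of x y] by (auto simp: Units_def)
      then show False using x(2) by simp
    qed
    then have "PIdl x \<in> family"
      using x(1) cgenideal_ideal cgenideal_self by (auto simp: family_def)
    then show "family \<noteq> {}" by auto
    fix C assume "C \<noteq> {}" and chain: "subset.chain family C"
    have id: "ideal I R" "x \<in> I" "\<one> \<notin> I" if "I \<in> C" for I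
      using that chain by (auto simp: subset_chain_def family_def)
    have "ideal (\<Union>C) R"
    proof (rule idealI[OF ring_axioms])
      show "subgroup (\<Union>C) (add_monoid R)"
      proof (rule add.subgroupI)
        show "\<Union>C \<subseteq> carrier R" using ideal.Icarr[OF id(1)] by auto
        show "\<Union>C \<noteq> {}" using \<open>C \<noteq> {}\<close> id(2) by auto
        show "\<ominus> a \<in> \<Union>C" if "a \<in> \<Union>C" for a
          using that additive_subgroup.a_inv_closed[OF ideal.axioms(1)[OF id(1)]] by auto
        show "a \<oplus> b \<in> \<Union>C" if ab: "a \<in> \<Union>C" "b \<in> \<Union>C" for a b
        proof -
          obtain I where "I \<in> C" "a \<in> I" "b \<in> I"
            using ab chain unfolding subset_chain_def by blast
          then have "a \<oplus> b \<in> I" using additive_subgroup.a_closed[OF ideal.axioms(1)[OF id(1)]] by blast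
          then show ?thesis using \<open>I \<in> C\<close> by auto
        qed
      qed
      show "y \<otimes> a \<in> \<Union>C" "a \<otimes> y \<in> \<Union>C" if "a \<in> \<Union>C" "y \<in> carrier R" for a y
        using that ideal.I_l_closed[OF id(1)] ideal.I_r_closed[OF id(1)] by blast+
    qed
    then show "\<Union>C \<in> family" using \<open>C \<noteq> {}\<close> id(2,3) by (auto simp: family_def)
  qed
  then obtain m where m: "m \<in> family" and max: "\<And>J. J \<in> family \<Longrightarrow> m \<subseteq> J \<Longrightarrow> J = m" by blast
  have "maximalideal m R"
  proof (rule maximalidealI)
    show "ideal m R" "carrier R \<noteq> m" using m by (auto simp: family_def)
    fix J assume J: "ideal J R" "m \<subseteq> J" "J \<subseteq> carrier R"
    show "J = m \<or> J = carrier R"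
    proof (cases "\<one> \<in> J")
      case True
      then show ?thesis using ideal.one_imp_carrier[OF J(1)] by simp
    next
      case False
      then show ?thesis using max[of J] J m by (auto simp: family_def)
    qed
  qed
  then show ?thesis using that m by (auto simp: family_def)
qed

lemma (in ideal) add_pow_Quot_one:
  fixes n :: nat
  shows "[n] \<cdot>\<^bsub>R Quot I\<^esub> \<one>\<^bsub>R Quot I\<^esub> = I +> ([n] \<cdot>\<^bsub>R\<^esub> \<one>\<^bsub>R\<^esub>)"
proof -
  interpret h: ring_hom_ring R "R Quot I" "(+>) I" by (rule rcos_ring_hom_ring)
  show ?thesis
  proof (induction n)
    case 0
    then show ?case using h.hom_zero by (simp add: add_pow_def nat_pow_def)
  next
    case (Suc n)
    then show ?case by simp
  qed
qed

lemma subset_ring_simps: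
  "carrier (subset_ring A) = A" "x \<otimes>\<^bsub>subset_ring A\<^esub> y = x * y" "x \<oplus>\<^bsub>subset_ring A\<^esub> y = x + y"
  "\<one>\<^bsub>subset_ring A\<^esub> = 1" "\<zero>\<^bsub>subset_ring A\<^esub> = 0"
  by (simp_all add: subset_ring_def ring_of_type_algebra_def)

text \<open>A nonunit \<open>e\<close> lies in the maximal ideal, so it vanishes in the residue field. The case \<open>e = 0\<close> is listed
  separately because \<open>1 / 0 = 0\<close> belongs to \<open>A\<close>.\<close>
lemma residue_char_dvd_nonunit:
  assumes A: "local_domain_with_quotient_field_UNIV A"
    and e: "of_nat e = (0 :: 'k) \<or> 1 / of_nat e \<notin> A"
  shows "residue_char (A :: 'k::field set) dvd e"
proof -
  let ?R = "subset_ring A"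
  have "cring ?R" and unique: "\<exists>!m. maximalideal m ?R"
    using A by (auto simp: local_domain_with_quotient_field_UNIV_def local_ring_def)
  interpret cring ?R by fact
  have pow: "[n] \<cdot>\<^bsub>?R\<^esub> \<one>\<^bsub>?R\<^esub> = of_nat n" for n :: nat
    by (induction n) (auto simp: subset_ring_simps add_pow_def nat_pow_def subset_ring_def ring_of_type_algebra_def)
  have "of_nat e \<in> carrier ?R" using add.nat_pow_closed[of "\<one>\<^bsub>?R\<^esub>" e] by (simp add: pow)
  moreover have "of_nat e \<notin> Units ?R"
  proof
    assume "of_nat e \<in> Units ?R"
    then obtain y where "y \<in> A" "y * of_nat e = 1" by (auto simp: Units_def subset_ring_simps)
    then show False using e by (metis mult_zero_right nonzero_eq_divide_eq zero_neq_one)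
  qed
  ultimately obtain m where m: "maximalideal m ?R" "of_nat e \<in> m" by (rule nonunit_in_maximalideal)
  then have "max_ideal ?R = m" unfolding max_ideal_def using unique by (intro the1_equality)
  interpret maximalideal m ?R by (rule m(1))
  have "[e] \<cdot>\<^bsub>?R Quot m\<^esub> \<one>\<^bsub>?R Quot m\<^esub> = \<zero>\<^bsub>?R Quot m\<^esub>"
    unfolding add_pow_Quot_one pow using a_rcos_const[OF m(2)] by (simp add: FactRing_def)
  then show ?thesis
    unfolding residue_char_def ring_char_def \<open>max_ideal ?R = m\<close> by (intro Gcd_dvd) simp
qed

section \<open>Transfer to the quotient ring\<close>

lemma poly_class_eq: "poly_class f g = {h. f dvd h - (g :: 'k::field poly)}"
proof -
  have "poly_class f g = {k * f + g | k. True}"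
    by (auto simp: poly_class_def cgenideal_def ring_of_type_algebra_def a_r_coset_def' )
  also have "\<dots> = {h. f dvd h - g}"
  proof (rule Set.set_eqI)
    fix h
    show "h \<in> {k * f + g | k. True} \<longleftrightarrow> h \<in> {h. f dvd h - g}"
    proof
      assume "h \<in> {h. f dvd h - g}"
      then obtain k where "h - g = f * k" by (auto elim: dvdE)
      then have "h = k * f + g" by (simp add: algebra_simps)
      then show "h \<in> {k * f + g | k. True}" by blast
    qed auto
  qed
  finally show ?thesis .
qed

lemma poly_class_eq_iff: "poly_class f g = poly_class f h \<longleftrightarrow> f dvd g - (h :: 'k::field poly)"
proof
  assume "poly_class f g = poly_class f h"
  moreover have "g \<in> poly_class f g" by (simp add: poly_class_eq)
  ultimately have "g \<in> poly_class f h" by simp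
  then show "f dvd g - h" by (simp add: poly_class_eq)
next
  assume gh: "f dvd g - h"
  have "f dvd k - g \<longleftrightarrow> f dvd k - h" for k
    using dvd_add[OF _ gh, of "k - g"] dvd_diff[OF _ gh, of "k - h"] by auto
  then show "poly_class f g = poly_class f h" by (simp add: poly_class_eq)
qed

lemma ring_hom_ring_poly_class:
  "ring_hom_ring (ring_of_type_algebra :: 'k::field poly ring) (poly_quot f) (poly_class f)"
proof -
  interpret R: cring "ring_of_type_algebra :: 'k poly ring" by (rule cring_from_type_algebra)
  interpret ideal "PIdl\<^bsub>ring_of_type_algebra\<^esub> f" "ring_of_type_algebra :: 'k poly ring"
    by (rule R.cgenideal_ideal) (simp add: ring_of_type_algebra_def)
  have "poly_class f = (+>\<^bsub>ring_of_type_algebra\<^esub>) (PIdl\<^bsub>ring_of_type_algebra\<^esub> f)"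
    by (simp add: fun_eq_iff poly_class_def)
  then show ?thesis unfolding poly_quot_def using rcos_ring_hom_ring by simp
qed

lemma poly_quot_simps:
  fixes f :: "'k::field poly"
  shows "carrier (poly_quot f) = range (poly_class f)"
    and "poly_class f g \<otimes>\<^bsub>poly_quot f\<^esub> poly_class f h = poly_class f (g * h)"
    and "poly_class f g \<oplus>\<^bsub>poly_quot f\<^esub> poly_class f h = poly_class f (g + h)"
    and "\<one>\<^bsub>poly_quot f\<^esub> = poly_class f 1" and "\<zero>\<^bsub>poly_quot f\<^esub> = poly_class f 0"
proof -
  interpret ring_hom_ring "ring_of_type_algebra :: 'k poly ring" "poly_quot f" "poly_class f"
    by (rule ring_hom_ring_poly_class)
  show "carrier (poly_quot f) = range (poly_class f)"
    by (auto simp: poly_quot_def FactRing_def A_RCOSETS_def' poly_class_def ring_of_type_algebra_def)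
  show "poly_class f g \<otimes>\<^bsub>poly_quot f\<^esub> poly_class f h = poly_class f (g * h)"
    "poly_class f g \<oplus>\<^bsub>poly_quot f\<^esub> poly_class f h = poly_class f (g + h)"
    "\<one>\<^bsub>poly_quot f\<^esub> = poly_class f 1" "\<zero>\<^bsub>poly_quot f\<^esub> = poly_class f 0"
    using hom_mult[of g h] hom_add[of g h] hom_one hom_zero by (simp_all add: ring_of_type_algebra_def)
qed

text \<open>A set \<open>S\<close> as in the locale is the preimage of its image \<open>V\<close> in \<open>K[x]/(f)\<close>, and \<open>V\<close> is a valuation ring there.\<close>
lemma unique_extension_of_is_unique_extension:
  fixes f :: "'k::field poly" and v :: "'k poly set \<Rightarrow> 'g::linordered_ab_group_add with_infty"
  assumes f: "Polynomial.lead_coeff f = 1" "Factorial_Ring.irreducible f"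
    and ext: "is_unique_extension v0 f v"
  shows "unique_extension (\<lambda>g. v (poly_class f g)) f"
proof -
  have v: "pseudo_valuation (poly_quot f) v" "infinity_ideal (poly_quot f) v = {poly_class f 0}"
    and const: "\<And>a. v (poly_class f [:a:]) = v0 a"
    using ext by (auto simp: is_unique_extension_def is_extension_def valuation_def poly_quot_simps)
  define u where "u = (\<lambda>g. v (poly_class f g))"
  have mult: "u (g * h) = u g + u h" and add: "min (u g) (u h) \<le> u (g + h)" for g h
    using v(1) by (auto simp: pseudo_valuation_def poly_quot_simps u_def simp flip: poly_quot_simps(2,3))
  have inf: "u g = Infty \<longleftrightarrow> f dvd g" for g
  proof -
    have "u g = Infty \<longleftrightarrow> poly_class f g \<in> infinity_ideal (poly_quot f) v"
      by (auto simp: infinity_ideal_def poly_quot_simps u_def)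
    then show ?thesis by (simp add: v(2) poly_class_eq_iff)
  qed
  have "\<not> f dvd 1" using f(2) by (auto simp: irreducible_def)
  have "u 1 = 0"
  proof (rule value_add_cancel)
    show "u 1 \<noteq> Infty" using \<open>\<not> f dvd 1\<close> by (simp add: inf)
    show "u 1 + u 1 = u 1 + 0" using mult[of 1 1] by simp
  qed
  interpret hom: ring_hom_ring "ring_of_type_algebra :: 'k poly ring" "poly_quot f" "poly_class f"
    by (rule ring_hom_ring_poly_class)
  have "unique_extension u f"
  proof
    fix S :: "'k poly set"
    assume S: "1 \<in> S" "\<And>g h. g \<in> S \<Longrightarrow> h \<in> S \<Longrightarrow> g - h \<in> S" "\<And>g h. g \<in> S \<Longrightarrow> h \<in> S \<Longrightarrow> g * h \<in> S"
      and cong: "\<And>g h. g \<in> S \<Longrightarrow> f dvd g - h \<Longrightarrow> h \<in> S"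
      and inverse: "\<And>g. \<not> f dvd g \<Longrightarrow> g \<in> S \<or> (\<exists>h\<in>S. f dvd g * h - 1)"
      and constants: "\<And>a. [:a:] \<in> S \<longleftrightarrow> 0 \<le> u [:a:]"
    let ?V = "poly_class f ` S"
    have mem: "poly_class f g \<in> ?V \<longleftrightarrow> g \<in> S" for g
      using cong by (auto simp: poly_class_eq_iff dvd_diff_commute)
    have neg: "- g \<in> S" if "g \<in> S" for g using S(2)[OF S(2)[OF S(1) S(1)] that] by simp
    have "subring S (ring_of_type_algebra :: 'k poly ring)"
    proof (rule hom.R.subringI)
      fix g h assume gh: "g \<in> S" "h \<in> S"
      have "\<ominus>\<^bsub>ring_of_type_algebra\<^esub> g = - g"
        by (rule hom.R.minus_equality[symmetric, THEN sym]) (auto simp: ring_of_type_algebra_def)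
      then show "\<ominus>\<^bsub>ring_of_type_algebra\<^esub> g \<in> S" using neg gh by simp
      show "g \<oplus>\<^bsub>ring_of_type_algebra\<^esub> h \<in> S"
        using S(2)[OF gh(1) neg[OF gh(2)]] by (simp add: ring_of_type_algebra_def)
    qed (use S in \<open>auto simp: ring_of_type_algebra_def\<close>)
    then have "subring ?V (poly_quot f)" by (rule hom.img_is_subring)
    moreover have "t \<in> ?V \<or> inv\<^bsub>poly_quot f\<^esub> t \<in> ?V" if t: "t \<in> carrier (poly_quot f) - {\<zero>\<^bsub>poly_quot f\<^esub>}" for t
    proof -
      obtain g where "t = poly_class f g" using t by (auto simp: poly_quot_simps(1))
      moreover from this have "\<not> f dvd g"
        using t poly_class_eq_iff[of f g 0] by (simp add: poly_quot_simps)
      ultimately have g: "t = poly_class f g" "\<not> f dvd g" .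
      show ?thesis
      proof (cases "g \<in> S")
        case False
        then obtain h where h: "h \<in> S" "f dvd g * h - 1" using inverse[OF g(2)] by blast
        have "cring (poly_quot f)"
        proof -
          interpret R: cring "ring_of_type_algebra :: 'k poly ring" by (rule cring_from_type_algebra)
          interpret ideal "PIdl\<^bsub>ring_of_type_algebra\<^esub> f" "ring_of_type_algebra :: 'k poly ring"
            by (rule R.cgenideal_ideal) (simp add: ring_of_type_algebra_def)
          show ?thesis unfolding poly_quot_def by (rule quotient_is_cring[OF R.cring_axioms])
        qed
        then interpret Q: cring "poly_quot f" .
        have "inv\<^bsub>poly_quot f\<^esub> t = poly_class f h"
          by (rule Q.comm_inv_char[of t])
            (use h in \<open>auto simp: g(1) poly_quot_simps poly_class_eq_iff\<close>)
        then show ?thesis using h(1) by auto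
      qed (use g in auto)
    qed
    ultimately have "valuation_subring ?V (poly_quot f)" by (simp add: valuation_subring_def)
    moreover have "{a. poly_class f [:a:] \<in> ?V} = valuation_ring ring_of_type_algebra v0"
      using constants by (auto simp: mem valuation_ring_def ring_of_type_algebra_def u_def const)
    ultimately have V: "?V = valuation_ring (poly_quot f) v" using ext by (simp add: is_unique_extension_def)
    have "g \<in> S \<longleftrightarrow> 0 \<le> u g" for g
    proof -
      have "g \<in> S \<longleftrightarrow> poly_class f g \<in> valuation_ring (poly_quot f) v" unfolding mem[symmetric] V ..
      then show ?thesis by (auto simp: valuation_ring_def poly_quot_simps u_def)
    qed
    then show "S = {g. 0 \<le> u g}" by auto
  qed (use f mult add inf \<open>u 1 = 0\<close> in auto)
  then show ?thesis by (simp add: u_def)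
qed

lemma (in unique_extension) pseudo_valuation: "pseudo_valuation ring_of_type_algebra u"
proof -
  interpret R: cring "ring_of_type_algebra :: 'k poly ring" by (rule cring_from_type_algebra)
  have I: "infinity_ideal ring_of_type_algebra u = PIdl\<^bsub>ring_of_type_algebra\<^esub> f"
    by (auto simp: infinity_ideal_def cgenideal_def ring_of_type_algebra_def infinite_iff dvd_def mult.commute)
  have "primeideal (PIdl\<^bsub>ring_of_type_algebra\<^esub> f) (ring_of_type_algebra :: 'k poly ring)"
  proof (rule primeidealI[OF R.cgenideal_ideal R.cring_axioms])
    have "1 \<notin> PIdl\<^bsub>ring_of_type_algebra\<^esub> f"
      unfolding I[symmetric] by (simp add: infinity_ideal_def)
    then show "carrier ring_of_type_algebra \<noteq> PIdl\<^bsub>ring_of_type_algebra\<^esub> f"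
      by (auto simp: ring_of_type_algebra_def)
    fix a b assume "a \<otimes>\<^bsub>ring_of_type_algebra\<^esub> b \<in> PIdl\<^bsub>ring_of_type_algebra\<^esub> f"
    then show "a \<in> PIdl\<^bsub>ring_of_type_algebra\<^esub> f \<or> b \<in> PIdl\<^bsub>ring_of_type_algebra\<^esub> f"
      unfolding I[symmetric] by (auto simp: infinity_ideal_def ring_of_type_algebra_def value_mult)
  qed (simp add: ring_of_type_algebra_def)
  then show ?thesis
    unfolding pseudo_valuation_def I
    using value_mult value_add by (auto simp: ring_of_type_algebra_def)
qed

theorem theorem4p2:
  fixes A :: "'k::field set"
    and v0 :: "'k \<Rightarrow> 'g::linordered_ab_group_add with_infty"
    and f :: "'k poly"
    and v :: "'k poly set \<Rightarrow> 'g with_infty"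
  assumes "local_domain_with_quotient_field_UNIV A"
    and "valuation ring_of_type_algebra v0"
    and "dominates v0 A"
    and "f \<in> polys_over A"
    and "Polynomial.lead_coeff f = 1"
    and "Factorial_Ring.irreducible f"
    and "\<not> residue_char A dvd Polynomial.degree f"
    and "is_unique_extension v0 f v"
  shows "\<exists>n \<phi> V.
      inductive_values v0 n \<phi> (\<lambda>k. v (poly_class f (\<phi> k))) V \<and>
      \<phi> n = f \<and>
      pseudo_valuation ring_of_type_algebra (V n) \<and>
      (\<forall>g. v (poly_class f g) = V n g) \<and>
      (\<forall>i\<in>{1..n}. \<phi> i \<in> polys_over A)"
proof -
  interpret unique_extension "\<lambda>g. v (poly_class f g)" f
    using assms by (intro unique_extension_of_is_unique_extension)
  have const: "v (poly_class f [:a:]) = v0 a" for a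
    using assms(8) by (simp add: is_unique_extension_def is_extension_def)
  have "subring A (ring_of_type_algebra :: 'k ring)"
    using assms(1) by (auto simp: local_domain_with_quotient_field_UNIV_def subdomain_def subcring_def)
  interpret F: cring "ring_of_type_algebra :: 'k ring" by (rule cring_from_type_algebra)
  have minus: "\<ominus>\<^bsub>ring_of_type_algebra\<^esub> a = - a" for a :: 'k
    by (rule F.minus_equality) (auto simp: ring_of_type_algebra_def)
  note A = subringE[OF \<open>subring A _\<close>]
  have "tame_extension (\<lambda>g. v (poly_class f g)) f A"
  proof
    show "1 \<in> A" using A(3) by (simp add: ring_of_type_algebra_def)
    fix a b assume "a \<in> A" "b \<in> A"
    then show "a - b \<in> A" "a * b \<in> A"
      using A(7)[OF _ A(5), of a b] A(6)[of a b] by (simp_all add: minus) (simp_all add: ring_of_type_algebra_def)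
  next
    fix a assume "a \<in> A"
    then show "0 \<le> v (poly_class f [:a:])"
      using assms(3) by (auto simp: const dominates_def valuation_ring_def)
  next
    fix e assume "e dvd pdeg f"
    then show "of_nat e \<noteq> (0 :: 'k) \<and> 1 / of_nat e \<in> A"
      using residue_char_dvd_nonunit[OF assms(1), of e] assms(7) dvd_trans by blast
  qed (rule assms)
  then interpret tame_extension "\<lambda>g. v (poly_class f g)" f A .
  show ?thesis using key_polynomials_over[of v0] const pseudo_valuation by metis
qed

end
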